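(* Let $\mathbf{p}(0)$ be a probability distribution on $\mathbb{N}=\{0,1,2,\ldots\}$ with mean $\lambda>0$ and finite variance $\sigma^2$, and let $\mathbf{p}(t)=(p_n(t))_{n\in\mathbb{N}}$, $t\ge 0$, be the solution of the infinite system of ordinary differential equations $$\frac{\mathrm{d}}{\mathrm{d}t}\mathbf{p}(t)=Q[\mathbf{p}(t)]$$ with initial condition $\mathbf{p}(0)$. Then, for all $t>0$, $$W_2(\mathbf{p}(t),\mathbf{p}_\lambda^* )\le C\,t^{-1/2},$$ where $C>0$ is a constant that only depends on the initial variance $\sigma^2$.
   Context: For a probability distribution $\mathbf{p}=(p_n)_{n\in\mathbb{N}}$ on $\mathbb{N}=\{0,1,2,\ldots\}$, the sequence $Q[\mathbf{p}]$ is defined by $$Q[\mathbf{p}]_n=\sum_{k=0}^\infty\sum_{\ell=0}^\infty \binom{k+\ell}{n}\frac{1}{2^{k+\ell}}\,p_k\,p_\ell\,\mathbf{1}_{\{n\le k+\ell\}}-p_n,\qquad n\in\mathbb{N},$$ with $\binom{0}{0}=1$. A solution of $\frac{\mathrm{d}}{\mathrm{d}t}\mathbf{p}(t)=Q[\mathbf{p}(t)]$ means a classical, global in time solution: for every $t\ge 0$ the sequence $\mathbf{p}(t)$ is a probability distribution on $\mathbb{N}$, and each $p_n$ is differentiable in $t$ with $p_n'(t)=Q[\mathbf{p}(t)]_n$. $\mathbf{p}_\lambda^*$ is the Poisson distribution with rate $\lambda>0$: $p_{\lambda,k}^*=\lambda^k e^{-\lambda}/k!$ for $k\in\mathbb{N}$.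 The $2$-Wasserstein distance between probability mass functions $\mathbf{p},\mathbf{q}$ on $\mathbb{N}$ is $$W_2(\mathbf{p},\mathbf{q})=\inf\left\{\sqrt{\mathbb{E}[|X-Y|^2]}:\ \mathrm{Law}(X)=\mathbf{p},\ \mathrm{Law}(Y)=\mathbf{q}\right\},$$ the infimum being over all pairs of (jointly defined) random variables $X,Y$ with laws $\mathbf{p}$ and $\mathbf{q}$.
   Formalization: The constant C is allowed to depend on the mean λ as well as on the initial variance σ², since a constant depending on σ² alone is impossible: for p(0) = δ_N (λ = N, σ² = 0) the distance at t = 1 is at least 0.37·√N. *)

theory Defs
  imports "HOL-Probability.Probability"
begin

text \<open>For a probability mass function both series below converge absolutely, since every
  summand lies between \<open>0\<close> and \<open>p k * p l\<close>.\<close>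

definition Q :: "(nat \<Rightarrow> real) \<Rightarrow> nat \<Rightarrow> real" where
  "Q p n = (\<Sum>k. \<Sum>l. real ((k + l) choose n) * (1 / 2 ^ (k + l)) * p k * p l * of_bool (n \<le> k + l))
             - p n"

text \<open>At \<open>t = 0\<close> the derivative is one-sided; the values of \<open>p\<close> at negative
  times play no role.\<close>

definition Q_solution :: "(real \<Rightarrow> nat pmf) \<Rightarrow> bool" where
  "Q_solution p \<longleftrightarrow>
     (\<forall>t\<ge>0. \<forall>n. ((\<lambda>s. pmf (p s) n) has_real_derivative Q (pmf (p t)) n) (at t within {0..}))"

definition ennreal_sqrt :: "ennreal \<Rightarrow> ennreal" where
  "ennreal_sqrt x = (if x = \<top> then \<top> else ennreal (sqrt (enn2real x)))"

text \<open>The quantity \<open>E[|X - Y|\<^sup>2]\<close> depends on a pair of jointly defined random variables only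
  through its joint law, so pairs \<open>(X, Y)\<close> are represented by their joint mass functions.
  The expectation is taken in the extended nonnegative reals, so that a coupling of infinite cost
  counts as infinite (the Bochner integral would give it the value 0).\<close>

definition couplings :: "'a pmf \<Rightarrow> 'b pmf \<Rightarrow> ('a \<times> 'b) pmf set" where
  "couplings p q = {\<pi>. map_pmf fst \<pi> = p \<and> map_pmf snd \<pi> = q}"

definition W2 :: "nat pmf \<Rightarrow> nat pmf \<Rightarrow> ennreal" where
  "W2 p q = (INF \<pi>\<in>couplings p q.
     ennreal_sqrt (\<integral>\<^sup>+ (x, y). ennreal (\<bar>real x - real y\<bar>\<^sup>2) \<partial>measure_pmf \<pi>))"

end

theory Submission
  imports Defs
begin

text \<open>
  The equation \<open>p' = Q p\<close> describes particles that carry units: at rate one, two independent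
  particles pool their \<open>k + l\<close> units and a fair coin decides which of the two gets each unit.
  Thus \<open>Q p = T p - p\<close>, where \<open>T p\<close> is the law of a \<open>Binomial (k + l) (1/2)\<close> variable for independent
  \<open>k\<close> and \<open>l\<close> of law \<open>p\<close> (\<open>Q_eq_collide\<close>), and the Poisson law is a fixed point of \<open>T\<close>.

  The distance to equilibrium is controlled by running the same dynamics on pairs. A state is a
  pair of numbers of units, and when two pairs collide, both coordinates are reshuffled with the
  same coins as far as possible (\<open>coupled_reshuffle\<close>). Each coordinate then follows the
  original dynamics. Starting from the independent coupling of \<open>p 0\<close> with the Poisson law, the
  evolved pair law has second marginal Poisson, and its first marginal is \<open>p t\<close> because
  solutions are unique (\<open>Q_solution_unique\<close>). Its cost \<open>w t\<close>, the second moment of the gap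
  between the coordinates, is therefore an upper bound for the squared Wasserstein distance.

  If two independent pairs with centred gaps \<open>U\<close> and \<open>V\<close> collide and \<open>D = U + V\<close>, the new gap
  has second moment \<open>E (D\<^sup>2 + \<bar>D\<bar>) / 4\<close>, while \<open>E D\<^sup>2\<close> is twice the old one. So \<open>w' = - A / 4\<close> with
  \<open>A = E (D\<^sup>2 - \<bar>D\<bar>)\<close>, which is nonnegative because \<open>D\<close> is an integer. Quantitatively, gaps of
  size at least two contribute to \<open>A\<close> proportionally to their second moment, and gaps of size one
  contribute when two nonzero gaps of the same sign meet; as gaps are centred, this contribution is
  at least the square of the probability of a nonzero gap. Hence \<open>w' \<le> - w\<^sup>2 / c\<close> (\<open>gap_dissipation\<close>), and
  \<open>w t \<le> c / t\<close> (\<open>quadratic_decay\<close>), where \<open>c\<close> depends on the initial cost,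
  \<open>\<sigma>\<^sup>2 + l\<close>, only. The square root of this bound is the rate \<open>t powr (- 1 / 2)\<close>.

  The coupled evolution is constructed explicitly as a Wild sum (\<open>evolve\<close>): a geometric mixture of
  laws indexed by the number of past collisions. Its expectations are power series in
  \<open>1 - exp (-t)\<close>, which yields the differential equations for the marginals and for \<open>w\<close> at once
  (\<open>evolve_has_derivative\<close>).
\<close>

section \<open>Expectations under discrete distributions\<close>

text \<open>Conditioning on the first stage of a two-stage experiment. Integrability of the whole makes the
  conditional expectations finite only for almost every \<open>x\<close>; elsewhere the Bochner integral
  returns \<open>0\<close>, which does no harm because these \<open>x\<close> form a null set.\<close>

lemma expectation_bind_pmf_nonneg:
  fixes f :: "'b \<Rightarrow> real"
  assumes f: "\<And>y. 0 \<le> f y" and int: "integrable (measure_pmf (bind_pmf M N)) f"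
  shows "integrable (measure_pmf M) (\<lambda>x. measure_pmf.expectation (N x) f)"
    and "measure_pmf.expectation (bind_pmf M N) f =
         measure_pmf.expectation M (\<lambda>x. measure_pmf.expectation (N x) f)"
proof -
  let ?E = "measure_pmf.expectation (bind_pmf M N) f"
  have tot: "(\<integral>\<^sup>+x. \<integral>\<^sup>+y. ennreal (f y) \<partial>N x \<partial>M) = ennreal ?E"
    using nn_integral_eq_integral[OF int] f by simp
  have "AE x in M. (\<integral>\<^sup>+y. ennreal (f y) \<partial>N x) \<noteq> \<infinity>"
    by (rule nn_integral_PInf_AE) (simp_all add: tot)
  then have "AE x in M. (\<integral>\<^sup>+y. ennreal (f y) \<partial>N x) = ennreal (measure_pmf.expectation (N x) f)"
  proof eventually_elim
    case (elim x)
    then have "integrable (N x) f"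
      using f by (intro integrableI_nonneg) (auto simp: top.not_eq_extremum)
    then show ?case
      using f by (intro nn_integral_eq_integral) auto
  qed
  then have "(\<integral>\<^sup>+x. ennreal (measure_pmf.expectation (N x) f) \<partial>M) = ennreal ?E"
    unfolding tot[symmetric] by (intro nn_integral_cong_AE) auto
  moreover have "0 \<le> ?E" and "\<And>x. 0 \<le> measure_pmf.expectation (N x) f"
    using f by simp_all
  ultimately have "integrable M (\<lambda>x. measure_pmf.expectation (N x) f) \<and>
      measure_pmf.expectation M (\<lambda>x. measure_pmf.expectation (N x) f) = ?E"
    by (subst nn_integral_eq_integrable[symmetric]) auto
  then show "integrable (measure_pmf M) (\<lambda>x. measure_pmf.expectation (N x) f)"
    and "?E = measure_pmf.expectation M (\<lambda>x. measure_pmf.expectation (N x) f)"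
    by auto
qed

lemma expectation_bind_pmf:
  fixes f :: "'b \<Rightarrow> real"
  assumes int: "integrable (measure_pmf (bind_pmf M N)) f"
  shows "measure_pmf.expectation (bind_pmf M N) f =
         measure_pmf.expectation M (\<lambda>x. measure_pmf.expectation (N x) f)"
proof -
  let ?p = "\<lambda>y. max 0 (f y)" and ?n = "\<lambda>y. max 0 (- f y)"
  let ?B = "measure_pmf (bind_pmf M N)"
  have ip: "integrable ?B ?p" and im: "integrable ?B ?n"
    using int by auto
  have AE_int: "AE x in M. integrable (N x) f"
  proof -
    have "(\<integral>\<^sup>+x. \<integral>\<^sup>+y. ennreal \<bar>f y\<bar> \<partial>N x \<partial>M) < \<infinity>"
      using int by (simp add: integrable_iff_bounded)
    then have "AE x in M. (\<integral>\<^sup>+y. ennreal \<bar>f y\<bar> \<partial>N x) \<noteq> \<infinity>"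
      by (intro nn_integral_PInf_AE) auto
    then show ?thesis
      by eventually_elim (auto simp: integrable_iff_bounded top.not_eq_extremum)
  qed
  have split: "f y = ?p y - ?n y" for y
    by auto
  have "measure_pmf.expectation (bind_pmf M N) f =
      measure_pmf.expectation (bind_pmf M N) ?p - measure_pmf.expectation (bind_pmf M N) ?n"
    unfolding Bochner_Integration.integral_diff[OF ip im, symmetric] split[symmetric] ..
  also have "\<dots> = measure_pmf.expectation M (\<lambda>x. measure_pmf.expectation (N x) ?p)
      - measure_pmf.expectation M (\<lambda>x. measure_pmf.expectation (N x) ?n)"
    using expectation_bind_pmf_nonneg(2)[OF _ ip] expectation_bind_pmf_nonneg(2)[OF _ im] by simp
  also have "\<dots> = measure_pmf.expectation M
      (\<lambda>x. measure_pmf.expectation (N x) ?p - measure_pmf.expectation (N x) ?n)"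
    by (intro Bochner_Integration.integral_diff[symmetric]
        expectation_bind_pmf_nonneg(1) ip im) auto
  also have "\<dots> = measure_pmf.expectation M (\<lambda>x. measure_pmf.expectation (N x) f)"
  proof (intro integral_cong_AE)
    show "AE x in M. measure_pmf.expectation (N x) ?p - measure_pmf.expectation (N x) ?n =
        measure_pmf.expectation (N x) f"
      using AE_int
    proof eventually_elim
      case (elim x)
      then have "measure_pmf.expectation (N x) f =
          measure_pmf.expectation (N x) ?p - measure_pmf.expectation (N x) ?n"
        by (subst Bochner_Integration.integral_diff[symmetric]) (auto simp flip: split)
      then show ?case by simp
    qed
  qed auto
  finally show ?thesis .
qed

lemma expectation_nat_pmf_sums:
  fixes g :: "nat \<Rightarrow> real"
  assumes "integrable (measure_pmf p) g"
  shows "(\<lambda>k. pmf p k * g k) sums measure_pmf.expectation p g"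
proof -
  have "integrable (count_space UNIV) (\<lambda>k. pmf p k * g k)"
    using assms by (simp add: measure_pmf_eq_density integrable_density)
  then have "(\<lambda>k. pmf p k * g k) sums (\<integral>k. pmf p k * g k \<partial>count_space UNIV)"
    by (rule sums_integral_count_space_nat)
  also have "(\<integral>k. pmf p k * g k \<partial>count_space UNIV) = measure_pmf.expectation p g"
    by (simp add: measure_pmf_eq_density integral_density)
  finally show ?thesis .
qed

lemma nat_pmf_expectation_eqI:
  fixes g :: "nat \<Rightarrow> real"
  assumes sums: "(\<lambda>k. pmf p k * g k) sums s" and nonneg: "\<And>k. 0 \<le> g k"
  shows "integrable (measure_pmf p) g" and "measure_pmf.expectation p g = s"
proof -
  have "integrable (count_space UNIV) (\<lambda>k. pmf p k * g k)"
    using sums nonneg by (simp add: integrable_count_space_nat_iff sums_iff abs_mult)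
  then show int: "integrable (measure_pmf p) g"
    by (simp add: measure_pmf_eq_density integrable_density)
  show "measure_pmf.expectation p g = s"
    using expectation_nat_pmf_sums[OF int] sums by (rule sums_unique2)
qed

lemma integrable_pmf_bounded:
  fixes f :: "'a \<Rightarrow> real"
  assumes "\<And>x. \<bar>f x\<bar> \<le> B"
  shows "integrable (measure_pmf p) f"
  using assms by (intro measure_pmf.integrable_const_bound[of _ B]) auto

lemma abs_expectation_pmf_le:
  fixes f :: "'a \<Rightarrow> real"
  assumes "\<And>x. \<bar>f x\<bar> \<le> B"
  shows "\<bar>measure_pmf.expectation p f\<bar> \<le> B"
proof -
  have "measure_pmf.expectation p f \<le> B" "- measure_pmf.expectation p f \<le> B"
    using assms
    by (auto intro!: measure_pmf.integral_le_const integrable_pmf_bounded[of f B]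
        integrable_pmf_bounded[of "\<lambda>x. - f x" B] AE_I2
        simp: abs_le_iff simp flip: Bochner_Integration.integral_minus)
  then show ?thesis by simp
qed

lemma expectation_nat_pmf_suminf:
  fixes g :: "nat \<Rightarrow> real"
  assumes "\<And>k. \<bar>g k\<bar> \<le> B"
  shows "measure_pmf.expectation p g = (\<Sum>k. pmf p k * g k)"
  using expectation_nat_pmf_sums[OF integrable_pmf_bounded[of g B p]] assms by (simp add: sums_iff)

lemma pair_pmf_product:
  fixes f :: "'a \<Rightarrow> real" and g :: "'b \<Rightarrow> real"
  assumes f: "integrable (measure_pmf \<mu>) f" and g: "integrable (measure_pmf \<nu>) g"
  shows "integrable (measure_pmf (pair_pmf \<mu> \<nu>)) (\<lambda>x. f (fst x) * g (snd x))"
    and "measure_pmf.expectation (pair_pmf \<mu> \<nu>) (\<lambda>x. f (fst x) * g (snd x)) =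
      measure_pmf.expectation \<mu> f * measure_pmf.expectation \<nu> g"
proof -
  have "(\<integral>\<^sup>+x. ennreal \<bar>f (fst x) * g (snd x)\<bar> \<partial>pair_pmf \<mu> \<nu>) =
      (\<integral>\<^sup>+a. ennreal \<bar>f a\<bar> \<partial>\<mu>) * (\<integral>\<^sup>+b. ennreal \<bar>g b\<bar> \<partial>\<nu>)"
    by (simp add: nn_integral_pair_pmf' abs_mult ennreal_mult nn_integral_cmult nn_integral_multc)
  also have "\<dots> < \<infinity>"
    using f g by (simp add: integrable_iff_bounded ennreal_mult_less_top)
  finally show int: "integrable (measure_pmf (pair_pmf \<mu> \<nu>)) (\<lambda>x. f (fst x) * g (snd x))"
    by (simp add: integrable_iff_bounded)
  show "measure_pmf.expectation (pair_pmf \<mu> \<nu>) (\<lambda>x. f (fst x) * g (snd x)) =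
      measure_pmf.expectation \<mu> f * measure_pmf.expectation \<nu> g"
  proof -
    have pair: "pair_pmf \<mu> \<nu> = bind_pmf \<mu> (\<lambda>a. map_pmf (Pair a) \<nu>)"
      by (simp add: pair_pmf_def map_pmf_def)
    show ?thesis
      using expectation_bind_pmf[OF int[unfolded pair]] by (simp add: pair)
  qed
qed

lemma integrable_pair_pmf_fst:
  fixes f :: "'a \<Rightarrow> real"
  assumes "integrable (measure_pmf \<mu>) f"
  shows "integrable (measure_pmf (pair_pmf \<mu> \<nu>)) (\<lambda>x. f (fst x))"
  using assms integrable_map_pmf_eq[of fst "pair_pmf \<mu> \<nu>" f] by (simp add: map_fst_pair_pmf)

lemma integrable_pair_pmf_snd:
  fixes f :: "'a \<Rightarrow> real"
  assumes "integrable (measure_pmf \<nu>) f"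
  shows "integrable (measure_pmf (pair_pmf \<mu> \<nu>)) (\<lambda>x. f (snd x))"
  using assms integrable_map_pmf_eq[of snd "pair_pmf \<mu> \<nu>" f] by (simp add: map_snd_pair_pmf)

section \<open>Quadratic collision dynamics and their Wild expansion\<close>

text \<open>The quadratic collision operator of a kernel \<open>S\<close>, where \<open>S a b\<close> is the law of what two
  colliding states \<open>a\<close> and \<open>b\<close> produce. The state space is arbitrary because the same theory
  is applied to single particles, with states in \<open>\<nat>\<close>, and to coupled pairs of particles,
  with states in \<open>\<nat> \<times> \<nat>\<close>.\<close>

definition collide :: "('a \<Rightarrow> 'a \<Rightarrow> 'a pmf) \<Rightarrow> 'a pmf \<Rightarrow> 'a pmf \<Rightarrow> 'a pmf" where
  "collide S \<mu> \<nu> = bind_pmf (pair_pmf \<mu> \<nu>) (\<lambda>(a, b). S a b)"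

text \<open>The \<open>n\<close>-th term of the Wild expansion: the law of a particle whose collision history is a
  binary tree with \<open>n\<close> collisions. Given \<open>n + 1\<close> collisions, the split of the remaining
  \<open>n\<close> between the two parents of the last collision is uniform.\<close>

function wild :: "('a \<Rightarrow> 'a \<Rightarrow> 'a pmf) \<Rightarrow> 'a pmf \<Rightarrow> nat \<Rightarrow> 'a pmf" where
  "wild S \<mu> 0 = \<mu>"
| "wild S \<mu> (Suc n) =
     bind_pmf (pmf_of_set {..n}) (\<lambda>j. collide S (wild S \<mu> j) (wild S \<mu> (n - j)))"
  by pat_completeness auto
termination
  by (relation "Wellfounded.measure (\<lambda>(S, \<mu>, n). n)") auto

text \<open>The Wild sum \<open>\<Sum>n. exp (-t) * (1 - exp (-t))^n * wild S \<mu> n\<close>: the number of collisions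
  in the history of a particle at time \<open>t\<close> is geometric.\<close>

definition evolve :: "('a \<Rightarrow> 'a \<Rightarrow> 'a pmf) \<Rightarrow> 'a pmf \<Rightarrow> real \<Rightarrow> 'a pmf" where
  "evolve S \<mu> t = bind_pmf (geometric_pmf (exp (- t))) (wild S \<mu>)"

lemma evolve_0: "evolve S \<mu> 0 = \<mu>"
  by (simp add: evolve_def bind_return_pmf)

text \<open>If \<open>h\<close> intertwines two kernels, it carries the dynamics of one to that of the other. This is
  how the marginals of a coupled evolution are identified below.\<close>

lemma map_pmf_collide:
  assumes "\<And>a b. map_pmf h (S a b) = S' (h a) (h b)"
  shows "map_pmf h (collide S \<mu> \<nu>) = collide S' (map_pmf h \<mu>) (map_pmf h \<nu>)"
  using assms unfolding collide_def
  by (simp add: map_bind_pmf case_prod_unfold bind_map_pmf flip: map_pair)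

lemma map_pmf_wild:
  assumes "\<And>a b. map_pmf h (S a b) = S' (h a) (h b)"
  shows "map_pmf h (wild S \<mu> n) = wild S' (map_pmf h \<mu>) n"
proof (induction n rule: less_induct)
  case (less n)
  show ?case
  proof (cases n)
    case (Suc m)
    then show ?thesis
      by (auto simp: map_bind_pmf map_pmf_collide[of h S S', OF assms] less intro!: bind_pmf_cong)
  qed simp
qed

lemma map_pmf_evolve:
  assumes "\<And>a b. map_pmf h (S a b) = S' (h a) (h b)"
  shows "map_pmf h (evolve S \<mu> t) = evolve S' (map_pmf h \<mu>) t"
  by (simp add: evolve_def map_bind_pmf map_pmf_wild[of h S S', OF assms])

lemma evolve_fixed_point:
  assumes "collide S \<mu> \<mu> = \<mu>"
  shows "evolve S \<mu> t = \<mu>"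
proof -
  have "wild S \<mu> n = \<mu>" for n
  proof (induction n rule: less_induct)
    case (less n)
    show ?case
    proof (cases n)
      case (Suc m)
      have "wild S \<mu> n = bind_pmf (pmf_of_set {..m}) (\<lambda>j. \<mu>)"
        unfolding Suc wild.simps by (intro bind_pmf_cong refl) (auto simp: less Suc assms)
      then show ?thesis by simp
    qed simp
  qed
  then have "wild S \<mu> = (\<lambda>_. \<mu>)" by auto
  then show ?thesis by (simp add: evolve_def)
qed

text \<open>Two independent geometric variables with a given sum \<open>n\<close> are uniform on the \<open>n + 1\<close>
  possible splittings of \<open>n\<close>, since every splitting has the same weight
  \<open>p\<^sup>2 * (1 - p)^n\<close>. The sum itself is negative binomial with parameter \<open>2\<close>.\<close>

lemma pair_geometric_pmf:
  assumes p: "0 < p" "p \<le> 1"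
  shows "pair_pmf (geometric_pmf p) (geometric_pmf p) =
    bind_pmf (neg_binomial_pmf 2 p) (\<lambda>n. map_pmf (\<lambda>j. (j, n - j)) (pmf_of_set {..n}))"
proof (rule pmf_eqI)
  fix x :: "nat \<times> nat"
  obtain a b where x: "x = (a, b)" by force
  have "pmf (map_pmf (\<lambda>j. (j, n - j)) (pmf_of_set {..n})) (a, b) =
      (if n = a + b then 1 / (a + b + 1) else 0)" for n
  proof (cases "n = a + b")
    case True
    have "pmf (map_pmf (\<lambda>j. (j, n - j)) (pmf_of_set {..n})) ((\<lambda>j. (j, n - j)) a) =
        pmf (pmf_of_set {..n}) a"
      by (rule pmf_map_inj') (auto simp: inj_on_def)
    with True show ?thesis by (simp add: add_ac)
  next
    case False
    then show ?thesis
      by (intro trans[OF pmf_map_outside]) auto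
  qed
  then have "pmf (bind_pmf (neg_binomial_pmf 2 p)
      (\<lambda>n. map_pmf (\<lambda>j. (j, n - j)) (pmf_of_set {..n}))) x =
      measure_pmf.expectation (neg_binomial_pmf 2 p) (\<lambda>n. if n = a + b then 1 / (a + b + 1) else 0)"
    by (simp add: pmf_bind x)
  also have "\<dots> = pmf (neg_binomial_pmf 2 p) (a + b) / (a + b + 1)"
    by (subst integral_measure_pmf_real[of "{a + b}"]) (auto split: if_splits)
  also have "\<dots> = p ^ 2 * (1 - p) ^ (a + b)"
    using p by (subst pmf_neg_binomial) (auto simp: binomial_eq_0_iff field_simps)
  also have "\<dots> = pmf (pair_pmf (geometric_pmf p) (geometric_pmf p)) x"
    using p by (simp add: x pmf_pair power_add power2_eq_square)
  finally show "pmf (pair_pmf (geometric_pmf p) (geometric_pmf p)) x =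
      pmf (bind_pmf (neg_binomial_pmf 2 p)
      (\<lambda>n. map_pmf (\<lambda>j. (j, n - j)) (pmf_of_set {..n}))) x" by simp
qed

lemma pair_bind_pmf:
  "pair_pmf (bind_pmf M f) (bind_pmf N g) =
     bind_pmf (pair_pmf M N) (\<lambda>(i, j). pair_pmf (f i) (g j))"
  unfolding pair_pmf_def
  by (simp add: bind_assoc_pmf bind_return_pmf) (subst (2) bind_commute_pmf, rule refl)

text \<open>The uniform splitting in the recursion for \<open>wild\<close> matches the one in
  \<open>pair_geometric_pmf\<close>, so colliding the Wild sum with itself only shifts the index and
  replaces the geometric weights by negative binomial ones.\<close>

lemma collide_evolve:
  assumes "0 \<le> t"
  shows "collide S (evolve S \<mu> t) (evolve S \<mu> t) =
    bind_pmf (neg_binomial_pmf 2 (exp (- t))) (\<lambda>n. wild S \<mu> (Suc n))"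
  using assms unfolding collide_def evolve_def pair_bind_pmf
  by (simp add: pair_geometric_pmf bind_assoc_pmf bind_map_pmf collide_def case_prod_unfold)

text \<open>The Wild sum solves the collision equation when tested against any nonnegative \<open>f\<close> whose
  expectations under the terms of the expansion are bounded. With \<open>u = 1 - exp (-t)\<close> and
  \<open>h u = (\<Sum>n. a n * u^n)\<close>, where \<open>a n\<close> is the expectation of \<open>f\<close> under the
  \<open>n\<close>-th term, the left side is \<open>exp (-t) * h u\<close>; the shifted negative binomial weights turn the
  collision term into \<open>exp (-t)^2 * h' u\<close>, and the claim is the product rule. It is used for
  indicators, to recover the infinite system of equations, and for the unbounded
  quadratic cost of a coupling.\<close>

lemma evolve_has_derivative:
  fixes f :: "'a \<Rightarrow> real"
  assumes f: "\<And>x. 0 \<le> f x"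
    and bound: "\<And>n. (\<integral>\<^sup>+x. ennreal (f x) \<partial>wild S \<mu> n) \<le> ennreal K"
    and t: "0 \<le> t"
  shows "((\<lambda>s. measure_pmf.expectation (evolve S \<mu> s) f) has_real_derivative
      measure_pmf.expectation (collide S (evolve S \<mu> t) (evolve S \<mu> t)) f
      - measure_pmf.expectation (evolve S \<mu> t) f) (at t within {0..})"
proof -
  define a where "a n = measure_pmf.expectation (wild S \<mu> n) f" for n
  define h where "h u = (\<Sum>n. a n * u ^ n)" for u :: real
  define h' where "h' u = (\<Sum>n. diffs a n * u ^ n)" for u :: real
  have int: "integrable (wild S \<mu> n) f" for n
    using f bound[of n] by (intro integrableI_nonneg) (auto simp: le_less_trans)
  have a_nonneg: "0 \<le> a n" for n
    unfolding a_def using f by simp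
  have a_le: "a n \<le> max 0 K" for n
  proof -
    have "ennreal (a n) \<le> ennreal K"
      using nn_integral_eq_integral[OF int[of n]] f bound[of n] by (simp add: a_def)
    then show ?thesis by (cases "K \<ge> 0") (auto simp: ennreal_neg max_def ennreal_le_iff)
  qed
  have a_abs: "\<bar>a n\<bar> \<le> max 0 K" for n
    using a_nonneg a_le by simp
  have mix: "measure_pmf.expectation (bind_pmf G (\<lambda>n. wild S \<mu> (k n))) f =
      (\<Sum>n. pmf G n * a (k n))"
    for G :: "nat pmf" and k
  proof -
    have "(\<integral>\<^sup>+x. ennreal (f x) \<partial>bind_pmf G (\<lambda>n. wild S \<mu> (k n))) \<le> (\<integral>\<^sup>+n. ennreal K \<partial>G)"
      by (simp add: nn_integral_mono bound del: nn_integral_const)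
    also have "\<dots> < \<infinity>"
      by simp
    finally have "integrable (bind_pmf G (\<lambda>n. wild S \<mu> (k n))) f"
      using f by (intro integrableI_nonneg) auto
    from expectation_bind_pmf[OF this]
    have "measure_pmf.expectation (bind_pmf G (\<lambda>n. wild S \<mu> (k n))) f =
        measure_pmf.expectation G (\<lambda>n. a (k n))"
      by (simp add: a_def)
    moreover have "(\<lambda>n. pmf G n * a (k n)) sums measure_pmf.expectation G (\<lambda>n. a (k n))"
      by (intro expectation_nat_pmf_sums integrable_pmf_bounded[of _ "max 0 K"] a_abs)
    ultimately show ?thesis
      by (simp add: sums_iff)
  qed
  have summ: "summable (\<lambda>n. a n * u ^ n)" if "\<bar>u\<bar> < 1" for u :: real
  proof (rule summable_comparison_test')
    show "summable (\<lambda>n. max 0 K * \<bar>u\<bar> ^ n)"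
      using that by (intro summable_mult summable_geometric) auto
    show "norm (a n * u ^ n) \<le> max 0 K * \<bar>u\<bar> ^ n" if "n \<ge> 0" for n
      using a_abs[of n] by (auto simp: abs_mult power_abs intro!: mult_right_mono)
  qed
  have h_deriv: "(h has_real_derivative h' u) (at u)" if "\<bar>u\<bar> < 1" for u
    unfolding h_def h'_def
    by (rule termdiffs_strong'[where K = 1]) (use summ that in auto)
  have E: "measure_pmf.expectation (evolve S \<mu> s) f = exp (- s) * h (1 - exp (- s))"
    if "0 \<le> s" for s
  proof -
    have "measure_pmf.expectation (evolve S \<mu> s) f =
        (\<Sum>n. exp (- s) * (a n * (1 - exp (- s)) ^ n))"
      unfolding evolve_def using that
      by (subst mix[where k = "\<lambda>n. n"]) (simp add: mult_ac)
    also have "\<dots> = exp (- s) * h (1 - exp (- s))"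
      unfolding h_def using that by (intro suminf_mult summ) auto
    finally show ?thesis .
  qed
  have "measure_pmf.expectation (collide S (evolve S \<mu> t) (evolve S \<mu> t)) f =
      (\<Sum>n. exp (- t) ^ 2 * (diffs a n * (1 - exp (- t)) ^ n))"
    unfolding collide_evolve[OF t] mix using t
    by (intro suminf_cong) (simp add: diffs_def pmf_neg_binomial algebra_simps)
  also have "\<dots> = exp (- t) ^ 2 * h' (1 - exp (- t))"
    unfolding h'_def using t
    by (intro suminf_mult termdiff_converges[of _ 1] summ) auto
  finally have C: "measure_pmf.expectation (collide S (evolve S \<mu> t) (evolve S \<mu> t)) f =
      exp (- t) ^ 2 * h' (1 - exp (- t))" .
  have "((\<lambda>s. exp (- s) * h (1 - exp (- s))) has_real_derivative
      exp (- t) ^ 2 * h' (1 - exp (- t)) - exp (- t) * h (1 - exp (- t))) (at t within {0..})"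
    using t
    by (auto intro!: derivative_eq_intros DERIV_chain2[OF h_deriv]
        simp: power2_eq_square algebra_simps)
  then show ?thesis
    unfolding C E[OF t]
    by (rule has_field_derivative_transform_within[where d = 1]) (use t E in auto)
qed

section \<open>The reshuffling equation and uniqueness of its solutions\<close>

abbreviation thin :: "nat \<Rightarrow> nat pmf" where
  "thin N \<equiv> binomial_pmf N (1 / 2)"

abbreviation reshuffle :: "nat \<Rightarrow> nat \<Rightarrow> nat pmf" where
  "reshuffle k l \<equiv> thin (k + l)"

lemma expectation_collide_bounded:
  fixes f :: "'a \<Rightarrow> real"
  assumes f: "\<And>x. \<bar>f x\<bar> \<le> B"
  shows "measure_pmf.expectation (collide S \<mu> \<nu>) f =
    measure_pmf.expectation \<mu> (\<lambda>a. measure_pmf.expectation \<nu>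
      (\<lambda>b. measure_pmf.expectation (S a b) f))"
proof -
  have "collide S \<mu> \<nu> = bind_pmf \<mu> (\<lambda>a. bind_pmf \<nu> (S a))"
    by (simp add: collide_def pair_pmf_def bind_assoc_pmf bind_return_pmf)
  then show ?thesis
    using f by (simp add: expectation_bind_pmf integrable_pmf_bounded[of f B])
qed

lemma Q_eq_collide: "Q (pmf p) n = pmf (collide reshuffle p p) n - pmf p n"
proof -
  have thin: "pmf (thin N) n = real (N choose n) * (1 / 2 ^ N) * of_bool (n \<le> N)" for N
  proof (cases "n \<le> N")
    case True
    then have "(1 / 2 :: real) ^ n * (1 / 2) ^ (N - n) = (1 / 2) ^ N"
      by (metis le_add_diff_inverse power_add)
    with True show ?thesis
      by (simp add: power_divide)
  qed (simp add: binomial_eq_0)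
  have "pmf (collide reshuffle p p) n =
      measure_pmf.expectation (collide reshuffle p p) (indicator {n})"
    by (simp add: measure_pmf_single)
  also have "\<dots> = measure_pmf.expectation p (\<lambda>k. measure_pmf.expectation p
      (\<lambda>l. pmf (reshuffle k l) n))"
    by (subst expectation_collide_bounded[of _ 1]) (auto simp: measure_pmf_single)
  also have "\<dots> = (\<Sum>k. pmf p k * (\<Sum>l. pmf p l * pmf (reshuffle k l) n))"
  proof -
    have bd: "\<bar>pmf (reshuffle k l) n\<bar> \<le> 1" for k l
      by (simp add: pmf_le_1 del: pmf_binomial)
    show ?thesis
      by (subst expectation_nat_pmf_suminf[of _ 1], rule abs_expectation_pmf_le, rule bd,
          subst expectation_nat_pmf_suminf[of _ 1], rule bd, rule refl)
  qed
  also have "\<dots> = (\<Sum>k. \<Sum>l. real ((k + l) choose n) * (1 / 2 ^ (k + l)) * pmf p k * pmf p l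
      * of_bool (n \<le> k + l))"
  proof (intro suminf_cong)
    fix k
    have "summable (\<lambda>l. pmf p l * pmf (reshuffle k l) n)"
      by (intro sums_summable[OF expectation_nat_pmf_sums] integrable_pmf_bounded[of _ 1])
        (simp add: pmf_le_1 del: pmf_binomial)
    then show "pmf p k * (\<Sum>l. pmf p l * pmf (reshuffle k l) n) =
        (\<Sum>l. real ((k + l) choose n) * (1 / 2 ^ (k + l)) * pmf p k * pmf p l
          * of_bool (n \<le> k + l))"
      by (subst suminf_mult[symmetric]) (auto simp: thin mult_ac simp del: pmf_binomial)
  qed
  finally show ?thesis by (simp add: Q_def)
qed

text \<open>The operator is quadratic: replacing \<open>p\<close> by \<open>q\<close> in one argument at a time costs
  \<open>K\<close> twice, in the dual (total variation) norm.\<close>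

lemma collide_contraction:
  fixes f :: "'a \<Rightarrow> real"
  assumes f: "\<And>x. \<bar>f x\<bar> \<le> 1"
    and K: "\<And>g :: 'a \<Rightarrow> real. (\<And>x. \<bar>g x\<bar> \<le> 1) \<Longrightarrow>
      \<bar>measure_pmf.expectation p g - measure_pmf.expectation q g\<bar> \<le> K"
  shows "\<bar>measure_pmf.expectation (collide S p p) f - measure_pmf.expectation (collide S q q) f\<bar>
    \<le> 2 * K"
proof -
  define g where "g a b = measure_pmf.expectation (S a b) f" for a b
  have g: "\<bar>g a b\<bar> \<le> 1" for a b
    unfolding g_def by (rule abs_expectation_pmf_le) (rule f)
  define G where "G r a = measure_pmf.expectation r (g a)" for r a
  have G: "\<bar>G r a\<bar> \<le> 1" for r a
    unfolding G_def by (rule abs_expectation_pmf_le) (rule g)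
  have "\<bar>measure_pmf.expectation p (\<lambda>a. G p a - G q a)\<bar> \<le> K"
    by (rule abs_expectation_pmf_le) (unfold G_def, rule K, rule g)
  moreover have "measure_pmf.expectation p (\<lambda>a. G p a - G q a) =
      measure_pmf.expectation p (G p) - measure_pmf.expectation p (G q)"
    by (intro Bochner_Integration.integral_diff integrable_pmf_bounded[of _ 1] G)
  moreover have "\<bar>measure_pmf.expectation p (G q) - measure_pmf.expectation q (G q)\<bar> \<le> K"
    by (rule K, rule G)
  moreover have C: "measure_pmf.expectation (collide S r r) f = measure_pmf.expectation r (G r)" for r
    unfolding G_def g_def by (rule expectation_collide_bounded[OF f])
  ultimately show ?thesis
    unfolding C by linarith
qed

text \<open>A solution satisfies the equation coordinate by coordinate only, so the argument runs over
  finitely supported test functions, whose expectations can be differentiated termwise, and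
  passes to bounded test functions by dominated convergence. The equation has Lipschitz constant
  \<open>2 + 1 = 3\<close>, and every induction step is one Picard iteration: a bound of
  \<open>2 * (3 * t)^m / m!\<close> on the distance bounds its derivative by three times as much,
  and integration from \<open>0\<close> gives the next bound.\<close>

lemma Q_solution_test_bound:
  assumes p: "Q_solution p" and q: "Q_solution q" and init: "p 0 = q 0"
    and t: "0 \<le> t" and f: "\<And>x. \<bar>f x\<bar> \<le> 1"
  shows "\<bar>measure_pmf.expectation (p t) f - measure_pmf.expectation (q t) f\<bar>
    \<le> 2 * ((3 * t) ^ m / fact m)"
  using t f
proof (induction m arbitrary: t f)
  case 0
  then have "\<bar>measure_pmf.expectation (p t) f\<bar> \<le> 1" "\<bar>measure_pmf.expectation (q t) f\<bar> \<le> 1"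
    by (auto intro: abs_expectation_pmf_le)
  then show ?case by simp
next
  case (Suc m)
  let ?E = "\<lambda>r. measure_pmf.expectation r"
  let ?b = "2 * ((3 * t) ^ Suc m / fact (Suc m))"
  have one_sided: "?E (p t) f - ?E (q t) f \<le> ?b"
    if fin: "finite {x. f x \<noteq> 0}" and f: "\<And>x. \<bar>f x\<bar> \<le> 1" for f :: "nat \<Rightarrow> real"
  proof -
    define A where "A = {x. f x \<noteq> 0}"
    have sum: "?E r f = (\<Sum>x\<in>A. pmf r x * f x)" for r :: "nat pmf"
      unfolding A_def using fin by (subst integral_measure_pmf_real[of A]) (auto simp: A_def mult_ac)
    \<comment> \<open>\<open>D\<close> is the slack in the claimed bound; the induction hypothesis makes it increase from \<open>0\<close>.\<close>
    define D where "D s = 2 * ((3 * s) ^ Suc m / fact (Suc m)) - (?E (p s) f - ?E (q s) f)" for s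
    define D' where "D' s = 6 * ((3 * s) ^ m / fact m)
        - ((?E (collide reshuffle (p s) (p s)) f - ?E (p s) f)
            - (?E (collide reshuffle (q s) (q s)) f - ?E (q s) f))" for s
    have sol: "((\<lambda>s. ?E (r s) f) has_real_derivative
        ?E (collide reshuffle (r s) (r s)) f - ?E (r s) f) (at s within {0..})"
      if "Q_solution r" "0 \<le> s" for r s
    proof -
      have "((\<lambda>s. \<Sum>x\<in>A. pmf (r s) x * f x) has_real_derivative
          (\<Sum>x\<in>A. Q (pmf (r s)) x * f x)) (at s within {0..})"
        using that unfolding Q_solution_def
        by (intro DERIV_sum DERIV_cmult_right) auto
      then show ?thesis
        by (simp add: sum Q_eq_collide left_diff_distrib sum_subtractf)
    qed
    have monomial: "((\<lambda>s. 2 * ((3 * s) ^ Suc m / fact (Suc m))) has_real_derivative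
        6 * ((3 * s) ^ m / fact m)) (at s within {0..})" for s :: real
    proof -
      have "((\<lambda>s. 3 * s) has_real_derivative 3) (at s within {0..})"
        by (auto intro!: derivative_eq_intros)
      from DERIV_cmult[OF DERIV_power_Suc[OF this, of m], of "2 / fact (Suc m)"]
      have "((\<lambda>s. 2 * ((3 * s) ^ Suc m / fact (Suc m))) has_real_derivative
          2 / fact (Suc m) * ((1 + real m) * (3 * (3 * s) ^ m))) (at s within {0..})"
        by (simp del: fact_Suc power_Suc of_nat_Suc)
      moreover have "2 / fact (Suc m) * ((1 + real m) * (3 * (3 * s) ^ m)) =
          6 * ((3 * s) ^ m / fact m)"
        by (simp add: divide_simps)
      ultimately show ?thesis by simp
    qed
    have deriv: "(D has_real_derivative D' s) (at s within {0..})" if "0 \<le> s" for s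
      unfolding D_def[abs_def] D'_def
      by (intro DERIV_diff monomial sol p q that)
    have D'_nonneg: "0 \<le> D' s" if s: "0 \<le> s" for s
    proof -
      have IH: "\<bar>?E (p s) g - ?E (q s) g\<bar> \<le> 2 * ((3 * s) ^ m / fact m)"
        if "\<And>x. \<bar>g x\<bar> \<le> 1" for g :: "nat \<Rightarrow> real"
        using Suc.IH[OF s that] .
      have "\<bar>?E (collide reshuffle (p s) (p s)) f - ?E (collide reshuffle (q s) (q s)) f\<bar>
          \<le> 2 * (2 * ((3 * s) ^ m / fact m))"
        by (rule collide_contraction) (use f IH in auto)
      moreover have "\<bar>?E (p s) f - ?E (q s) f\<bar> \<le> 2 * ((3 * s) ^ m / fact m)"
        by (rule IH) (rule f)
      ultimately show ?thesis
        unfolding D'_def by linarith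
    qed
    have "D 0 \<le> D t"
    proof (rule DERIV_nonneg_imp_increasing_open[where f = D])
      show "0 \<le> t" by (rule Suc.prems(1))
      fix s assume "0 < s" "s < t"
      then have "at s within {0..} = at s"
        by (intro at_within_interior) (simp add: interior_real_atLeast)
      with \<open>0 < s\<close> deriv[of s] D'_nonneg[of s]
      show "\<exists>y. (D has_real_derivative y) (at s) \<and> 0 \<le> y"
        by auto
    next
      show "continuous_on {0..t} D"
        by (rule DERIV_continuous_on[of _ _ D'])
          (auto intro: DERIV_subset[OF deriv])
    qed
    then show ?thesis
      by (simp add: D_def init)
  qed
  have two_sided: "\<bar>?E (p t) f - ?E (q t) f\<bar> \<le> ?b"
    if "finite {x. f x \<noteq> 0}" and "\<And>x. \<bar>f x\<bar> \<le> 1" for f :: "nat \<Rightarrow> real"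
    using one_sided[of f] one_sided[of "\<lambda>x. - f x"] that by simp
  have approx: "(\<lambda>N. ?E r (\<lambda>x. f x * indicator {..<N} x)) \<longlonglongrightarrow> ?E r f" for r :: "nat pmf"
  proof (rule integral_dominated_convergence[where w = "\<lambda>_. 1"])
    show "AE x in r. (\<lambda>N. f x * indicator {..<N} x) \<longlonglongrightarrow> f x"
    proof (rule AE_I2)
      fix x
      have "eventually (\<lambda>N. f x * indicator {..<N} x = f x) sequentially"
        using eventually_gt_at_top[of x] by eventually_elim simp
      then show "(\<lambda>N. f x * indicator {..<N} x) \<longlonglongrightarrow> f x"
        by (rule tendsto_eventually)
    qed
    show "AE x in r. norm (f x * indicator {..<N} x) \<le> 1" for N
      using Suc.prems(2) by (auto simp: abs_mult indicator_def)
  qed auto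
  show ?case
  proof (rule LIMSEQ_le_const2)
    show "(\<lambda>N. \<bar>?E (p t) (\<lambda>x. f x * indicator {..<N} x) - ?E (q t) (\<lambda>x. f x * indicator {..<N} x)\<bar>)
        \<longlonglongrightarrow> \<bar>?E (p t) f - ?E (q t) f\<bar>"
      by (intro tendsto_intros approx)
    have "finite {x. f x * indicator {..<N} x \<noteq> 0}" for N
      by (rule finite_subset[of _ "{..<N}"]) (auto simp: indicator_def split: if_splits)
    moreover have "\<bar>f x * indicator {..<N} x\<bar> \<le> 1" for N x
      using Suc.prems(2) by (auto simp: indicator_def)
    ultimately show "\<exists>N. \<forall>n\<ge>N. \<bar>?E (p t) (\<lambda>x. f x * indicator {..<n} x)
        - ?E (q t) (\<lambda>x. f x * indicator {..<n} x)\<bar> \<le> ?b"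
      by (intro exI[of _ 0] allI impI two_sided) (simp_all only:)
  qed
qed

lemma Q_solution_unique:
  assumes p: "Q_solution p" and q: "Q_solution q" and init: "p 0 = q 0" and t: "0 \<le> t"
  shows "p t = q t"
proof (rule pmf_eqI)
  fix n
  let ?d = "\<bar>pmf (p t) n - pmf (q t) n\<bar>"
  have "?d \<le> 2 * ((3 * t) ^ m / fact m)" for m
    using Q_solution_test_bound[OF p q init t, of "indicator {n}" m]
    by (simp add: measure_pmf_single indicator_def)
  moreover have "(\<lambda>m. 2 * ((3 * t) ^ m / fact m)) \<longlonglongrightarrow> 2 * 0"
    using summable_LIMSEQ_zero[OF summable_exp[of "3 * t"]]
    by (intro tendsto_intros) (simp add: field_simps)
  ultimately have "?d \<le> 0"
    by (intro LIMSEQ_le_const) auto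
  then show "pmf (p t) n = pmf (q t) n" by simp
qed

lemma Q_solution_evolve: "Q_solution (evolve reshuffle \<mu>)"
  unfolding Q_solution_def
proof (intro allI impI)
  fix t :: real and n
  assume t: "0 \<le> t"
  have "(\<integral>\<^sup>+x. ennreal (indicator {n} x) \<partial>wild reshuffle \<mu> m) \<le> ennreal 1" for m
    by (simp add: ennreal_indicator measure_pmf.emeasure_le_1)
  from evolve_has_derivative[OF _ this t]
  show "((\<lambda>s. pmf (evolve reshuffle \<mu> s) n) has_real_derivative
      Q (pmf (evolve reshuffle \<mu> t)) n) (at t within {0..})"
    by (simp add: Q_eq_collide measure_pmf_single)
qed

lemma thin_add: "bind_pmf (thin m) (\<lambda>c. map_pmf ((+) c) (thin k)) = thin (m + k)"
proof (induction m)
  case (Suc m)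
  have "bind_pmf (thin (Suc m)) (\<lambda>c. map_pmf ((+) c) (thin k)) =
      bind_pmf (bernoulli_pmf (1 / 2)) (\<lambda>b. map_pmf ((+) (if b then 1 else 0))
        (bind_pmf (thin m) (\<lambda>c. map_pmf ((+) c) (thin k))))"
    by (simp add: binomial_pmf_Suc bind_assoc_pmf bind_return_pmf map_bind_pmf map_pmf_comp add_ac)
      (intro bind_pmf_cong map_pmf_cong refl, simp)
  also have "\<dots> = thin (Suc m + k)"
    unfolding Suc by (simp add: binomial_pmf_Suc map_pmf_def)
  finally show ?case .
qed (simp add: binomial_pmf_0 bind_return_pmf map_pmf_def bind_return_pmf')

section \<open>Poisson equilibrium\<close>

lemma poisson_moments:
  assumes l: "0 < l"
  shows "integrable (measure_pmf (poisson_pmf l)) real"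
    and "measure_pmf.expectation (poisson_pmf l) real = l"
    and "integrable (measure_pmf (poisson_pmf l)) (\<lambda>k. (real k - l)\<^sup>2)"
    and "measure_pmf.expectation (poisson_pmf l) (\<lambda>k. (real k - l)\<^sup>2) = l"
proof -
  let ?P = "poisson_pmf l"
  \<comment> \<open>Stein identity of the Poisson law\<close>
  have step: "(\<lambda>k. pmf ?P k * (real k * f k)) sums (l * s)"
    if "(\<lambda>k. pmf ?P k * f (Suc k)) sums s" for f :: "nat \<Rightarrow> real" and s
  proof -
    have "(\<lambda>k. l * (pmf ?P k * f (Suc k))) sums (l * s)"
      by (rule sums_mult[OF that])
    moreover have "l * (pmf ?P k * f (Suc k)) = pmf ?P (Suc k) * (real (Suc k) * f (Suc k))" for k
      using l by (simp add: divide_simps del: of_nat_Suc)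
    ultimately show ?thesis
      using sums_Suc[of "\<lambda>k. pmf ?P k * (real k * f k)" "l * s"] by simp
  qed
  have total: "pmf ?P sums 1"
    using expectation_nat_pmf_sums[of ?P "\<lambda>_. 1"] by simp
  have "(\<lambda>k. pmf ?P k * real k) sums l"
    using step[of "\<lambda>_. 1" 1] total by simp
  note mean = nat_pmf_expectation_eqI[OF this]
  show int: "integrable (measure_pmf ?P) real" and E: "measure_pmf.expectation ?P real = l"
    using mean by simp_all
  \<comment> \<open>The identity with \<open>f k = k\<close> gives the second moment.\<close>
  have "(\<lambda>k. pmf ?P k * real k + pmf ?P k) sums (l + 1)"
    by (intro sums_add total \<open>(\<lambda>k. pmf ?P k * real k) sums l\<close>)
  then have "(\<lambda>k. pmf ?P k * (real k)\<^sup>2) sums (l * (l + 1))"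
    using step[of real "l + 1"] by (simp add: power2_eq_square algebra_simps)
  note second = nat_pmf_expectation_eqI[OF this]
  have expand: "(real k - l)\<^sup>2 = (real k)\<^sup>2 - 2 * l * real k + l\<^sup>2" for k
    by (simp add: power2_eq_square algebra_simps)
  show "integrable (measure_pmf ?P) (\<lambda>k. (real k - l)\<^sup>2)"
    unfolding expand using second int by auto
  show "measure_pmf.expectation ?P (\<lambda>k. (real k - l)\<^sup>2) = l"
    unfolding expand using second int E by (simp add: power2_eq_square algebra_simps)
qed

text \<open>The sum of two independent Poisson variables of rate \<open>l\<close> is Poisson of rate \<open>2 * l\<close>, and
  thinning by fair coins halves the rate.\<close>

lemma collide_poisson:
  assumes l: "0 < l"
  shows "collide reshuffle (poisson_pmf l) (poisson_pmf l) = poisson_pmf l"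
proof -
  let ?P = "poisson_pmf l"
  have sum: "map_pmf (\<lambda>(k, l). k + l) (pair_pmf ?P ?P) = poisson_pmf (2 * l)"
  proof (rule pmf_eqI)
    fix N
    have pm: "pmf (map_pmf (\<lambda>j. k + j) ?P) N = (if k \<le> N then pmf ?P (N - k) else 0)" for k
    proof (cases "k \<le> N")
      case True
      then show ?thesis using pmf_map_inj'[of "\<lambda>j. k + j" ?P "N - k"] by (simp add: inj_def)
    next
      case False
      then show ?thesis by (intro trans[OF pmf_map_outside]) auto
    qed
    have "pmf (map_pmf (\<lambda>(k, l). k + l) (pair_pmf ?P ?P)) N =
        measure_pmf.expectation ?P (\<lambda>k. if k \<le> N then pmf ?P (N - k) else 0)"
      unfolding pair_pmf_def map_bind_pmf
      by (simp add: map_bind_pmf pmf_bind flip: map_pmf_def pm)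
    also have "\<dots> = (\<Sum>k\<le>N. pmf ?P (N - k) * pmf ?P k)"
      by (subst integral_measure_pmf_real[of "{..N}"]) (auto split: if_splits)
    also have "\<dots> = (\<Sum>k\<le>N. exp (- (2 * l)) * l ^ N / fact N * real (N choose k))"
    proof (rule sum.cong[OF refl])
      fix k assume "k \<in> {..N}"
      then have k: "k \<le> N" by simp
      have "l ^ (N - k) * l ^ k = l ^ N"
        using k by (simp flip: power_add)
      moreover have "exp (- (2 * l)) = exp (- l) * exp (- l)"
        by (simp flip: exp_add)
      ultimately show "pmf ?P (N - k) * pmf ?P k = exp (- (2 * l)) * l ^ N / fact N * real (N choose k)"
        using l by (simp add: binomial_fact[OF k] field_simps)
    qed
    also have "\<dots> = exp (- (2 * l)) * l ^ N / fact N * 2 ^ N"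
      by (simp only: sum_distrib_left[symmetric] of_nat_sum[symmetric] choose_row_sum)
        simp
    also have "\<dots> = pmf (poisson_pmf (2 * l)) N"
      using l by (simp add: power_mult_distrib)
    finally show "pmf (map_pmf (\<lambda>(k, l). k + l) (pair_pmf ?P ?P)) N = pmf (poisson_pmf (2 * l)) N" .
  qed
  have "collide reshuffle ?P ?P = bind_pmf (map_pmf (\<lambda>(k, l). k + l) (pair_pmf ?P ?P)) thin"
    unfolding collide_def bind_map_pmf by (simp add: case_prod_unfold)
  also have "\<dots> = bind_pmf (poisson_pmf (2 * l)) thin"
    unfolding sum ..
  also have "\<dots> = ?P"
  proof (rule pmf_eqI)
    fix n
    let ?g = "\<lambda>N. pmf (poisson_pmf (2 * l)) N * pmf (thin N) n"
    have "?g sums pmf (bind_pmf (poisson_pmf (2 * l)) thin) n"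
      unfolding pmf_bind
      by (intro expectation_nat_pmf_sums integrable_pmf_bounded[of _ 1])
        (simp add: pmf_le_1 del: pmf_binomial)
    moreover have "?g sums pmf ?P n"
    proof -
      \<comment> \<open>Only \<open>N \<ge> n\<close> contributes; with \<open>N = m + n\<close> the terms form an exponential series.\<close>
      have shift: "?g (m + n) = exp (- (2 * l)) * l ^ n / fact n * (l ^ m / fact m)" for m
      proof -
        have "real ((m + n) choose n) = fact (m + n) / (fact n * fact m)"
          by (subst binomial_fact) auto
        then show ?thesis
          using l by (simp add: power_add power_mult_distrib power_divide field_simps)
      qed
      have "(\<lambda>m. l ^ m / fact m) sums exp l"
        using exp_converges[of l] by (simp add: field_simps)
      then have "(\<lambda>m. ?g (m + n)) sums (exp (- (2 * l)) * l ^ n / fact n * exp l)"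
        unfolding shift by (rule sums_mult)
      moreover have "exp (- (2 * l)) * l ^ n / fact n * exp l = pmf ?P n"
        using l by (simp add: field_simps flip: exp_add)
      moreover have "(\<Sum>i<n. ?g i) = 0"
        by (intro sum.neutral) (auto simp: binomial_eq_0)
      ultimately show ?thesis
        using sums_iff_shift[of ?g n "pmf ?P n"] by simp
    qed
    ultimately show "pmf (bind_pmf (poisson_pmf (2 * l)) thin) n = pmf ?P n"
      by (rule sums_unique2)
  qed
  finally show ?thesis .
qed

section \<open>A coupling of two collisions by shared coins\<close>

lemma expectation_thin_Suc:
  fixes f :: "nat \<Rightarrow> real"
  shows "measure_pmf.expectation (thin (Suc N)) f =
    (measure_pmf.expectation (thin N) (\<lambda>k. f (Suc k)) + measure_pmf.expectation (thin N) f) / 2"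
proof -
  have suc: "thin (Suc N) = bind_pmf (bernoulli_pmf (1 / 2))
      (\<lambda>b. map_pmf (\<lambda>k. (if b then 1 else 0) + k) (thin N))"
    by (simp add: binomial_pmf_Suc map_pmf_def)
  have "integrable (thin (Suc N)) f"
    by simp
  from expectation_bind_pmf[OF this[unfolded suc]] show ?thesis
    unfolding suc by (simp add: field_simps)
qed

lemma expectation_thin: "measure_pmf.expectation (thin N) real = real N / 2"
  by (induction N) (simp_all add: expectation_thin_Suc binomial_pmf_0 field_simps)

lemma expectation_thin_square:
  "measure_pmf.expectation (thin N) (\<lambda>k. (real k)\<^sup>2) = ((real N)\<^sup>2 + real N) / 4"
proof (induction N)
  case (Suc N)
  have "measure_pmf.expectation (thin N) (\<lambda>k. (real (Suc k))\<^sup>2) =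
      measure_pmf.expectation (thin N) (\<lambda>k. (real k)\<^sup>2 + (2 * real k + 1))"
    by (intro Bochner_Integration.integral_cong) (auto simp: power2_eq_square algebra_simps)
  also have "\<dots> = ((real N)\<^sup>2 + real N) / 4 + (real N + 1)"
    by (simp add: Suc expectation_thin)
  finally show ?case
    by (simp only: expectation_thin_Suc Suc) (simp add: power2_eq_square field_simps)
qed (simp add: binomial_pmf_0)

text \<open>Two collisions, one in each coordinate, which share as many coins as possible: the particles
  together hold \<open>N\<close> and \<open>M\<close> units, the first \<open>min N M\<close> of which are tossed with the same
  coins. Subtraction is truncated, so at most one of the two remainders is nonzero.\<close>

definition coupled_reshuffle :: "nat \<times> nat \<Rightarrow> nat \<times> nat \<Rightarrow> (nat \<times> nat) pmf" where
  "coupled_reshuffle a b =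
    (let N = fst a + fst b; M = snd a + snd b in
      bind_pmf (thin (min N M)) (\<lambda>c.
        map_pmf (\<lambda>(d, e). (c + d, c + e)) (pair_pmf (thin (N - M)) (thin (M - N)))))"

lemma map_fst_coupled_reshuffle:
  "map_pmf fst (coupled_reshuffle a b) = reshuffle (fst a) (fst b)"
proof -
  define N M where "N = fst a + fst b" and "M = snd a + snd b"
  have "map_pmf fst (coupled_reshuffle a b) = bind_pmf (thin (min N M))
      (\<lambda>c. map_pmf ((+) c) (map_pmf fst (pair_pmf (thin (N - M)) (thin (M - N)))))"
    by (simp add: coupled_reshuffle_def Let_def N_def M_def map_bind_pmf map_pmf_comp
        case_prod_unfold)
  also have "\<dots> = thin (min N M + (N - M))"
    unfolding map_fst_pair_pmf thin_add ..
  also have "min N M + (N - M) = N" by simp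
  finally show ?thesis by (simp add: N_def)
qed

lemma map_snd_coupled_reshuffle:
  "map_pmf snd (coupled_reshuffle a b) = reshuffle (snd a) (snd b)"
proof -
  define N M where "N = fst a + fst b" and "M = snd a + snd b"
  have "map_pmf snd (coupled_reshuffle a b) = bind_pmf (thin (min N M))
      (\<lambda>c. map_pmf ((+) c) (map_pmf snd (pair_pmf (thin (N - M)) (thin (M - N)))))"
    by (simp add: coupled_reshuffle_def Let_def N_def M_def map_bind_pmf map_pmf_comp
        case_prod_unfold)
  also have "\<dots> = thin (min N M + (M - N))"
    unfolding map_snd_pair_pmf thin_add ..
  also have "min N M + (M - N) = M" by simp
  finally show ?thesis by (simp add: M_def)
qed

definition gap :: "nat \<times> nat \<Rightarrow> real" where
  "gap a = real (fst a) - real (snd a)"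

text \<open>The shared coins cancel, and the new gap is a binomial variable on \<open>\<bar>gap a + gap b\<bar>\<close>
  tosses, up to its sign.\<close>

lemma nn_integral_gap_coupled_reshuffle:
  "(\<integral>\<^sup>+x. ennreal ((gap x)\<^sup>2) \<partial>coupled_reshuffle a b) =
    ennreal (((gap a + gap b)\<^sup>2 + \<bar>gap a + gap b\<bar>) / 4)"
proof -
  define N M where "N = fst a + fst b" and "M = snd a + snd b"
  have thin_square: "(\<integral>\<^sup>+k. ennreal ((real k)\<^sup>2) \<partial>thin j) = ennreal (((real j)\<^sup>2 + real j) / 4)"
    for j
    by (subst nn_integral_eq_integral) (simp_all add: expectation_thin_square)
  have "(\<integral>\<^sup>+x. ennreal ((gap x)\<^sup>2) \<partial>coupled_reshuffle a b) =
      (\<integral>\<^sup>+d. \<integral>\<^sup>+e. ennreal ((real d - real e)\<^sup>2) \<partial>thin (M - N) \<partial>thin (N - M))"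
    by (simp add: coupled_reshuffle_def Let_def N_def M_def gap_def case_prod_unfold
        nn_integral_pair_pmf' add_diff_add)
  also have "\<dots> = ennreal (((real N - real M)\<^sup>2 + \<bar>real N - real M\<bar>) / 4)"
  proof (cases "N \<le> M")
    case True
    then show ?thesis
      by (simp add: binomial_pmf_0 thin_square of_nat_diff power2_commute)
  next
    case False
    then show ?thesis
      by (simp add: binomial_pmf_0 thin_square of_nat_diff)
  qed
  also have "real N - real M = gap a + gap b"
    by (simp add: N_def M_def gap_def)
  finally show ?thesis .
qed

text \<open>The class of couplings in which the evolution lives. The moments are stated as nonnegative
  integrals because these are additive under mixtures without integrability conditions.\<close>

definition balanced :: "real \<Rightarrow> real \<Rightarrow> (nat \<times> nat) pmf \<Rightarrow> bool" where
  "balanced l K \<mu> \<longleftrightarrow>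
    (\<integral>\<^sup>+x. ennreal (real (fst x)) \<partial>\<mu>) = ennreal l \<and>
    (\<integral>\<^sup>+x. ennreal (real (snd x)) \<partial>\<mu>) = ennreal l \<and>
    (\<integral>\<^sup>+x. ennreal ((gap x)\<^sup>2) \<partial>\<mu>) \<le> ennreal K"

lemma balanced_bind_pmf:
  assumes "\<And>i. i \<in> set_pmf M \<Longrightarrow> balanced l K (N i)"
  shows "balanced l K (bind_pmf M N)"
proof -
  have mean: "(\<integral>\<^sup>+i. (\<integral>\<^sup>+x. ennreal (real (f x)) \<partial>N i) \<partial>M) = ennreal l"
    if "\<And>i. i \<in> set_pmf M \<Longrightarrow> (\<integral>\<^sup>+x. ennreal (real (f x)) \<partial>N i) = ennreal l"
    for f :: "nat \<times> nat \<Rightarrow> nat"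
  proof -
    have "(\<integral>\<^sup>+i. (\<integral>\<^sup>+x. ennreal (real (f x)) \<partial>N i) \<partial>M) = (\<integral>\<^sup>+i. ennreal l \<partial>M)"
      by (rule nn_integral_cong_AE) (simp add: AE_measure_pmf_iff that)
    then show ?thesis by simp
  qed
  have "(\<integral>\<^sup>+i. (\<integral>\<^sup>+x. ennreal ((gap x)\<^sup>2) \<partial>N i) \<partial>M) \<le> (\<integral>\<^sup>+i. ennreal K \<partial>M)"
    by (rule nn_integral_mono_AE) (use assms in \<open>simp add: AE_measure_pmf_iff balanced_def\<close>)
  then show ?thesis
    using assms mean[of fst] mean[of snd] by (simp add: balanced_def)
qed

lemma balanced_gap:
  assumes "balanced l K \<mu>" and l: "0 \<le> l" and K: "0 \<le> K"
  shows "integrable (measure_pmf \<mu>) gap"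
    and "measure_pmf.expectation \<mu> gap = 0"
    and "integrable (measure_pmf \<mu>) (\<lambda>x. (gap x)\<^sup>2)"
    and "(\<integral>\<^sup>+x. ennreal ((gap x)\<^sup>2) \<partial>\<mu>) = ennreal (measure_pmf.expectation \<mu> (\<lambda>x. (gap x)\<^sup>2))"
    and "measure_pmf.expectation \<mu> (\<lambda>x. (gap x)\<^sup>2) \<le> K"
proof -
  have 1: "integrable \<mu> (\<lambda>x. real (fst x)) \<and> measure_pmf.expectation \<mu> (\<lambda>x. real (fst x)) = l"
    using assms by (subst nn_integral_eq_integrable[symmetric]) (auto simp: balanced_def)
  have 2: "integrable \<mu> (\<lambda>x. real (snd x)) \<and> measure_pmf.expectation \<mu> (\<lambda>x. real (snd x)) = l"
    using assms by (subst nn_integral_eq_integrable[symmetric]) (auto simp: balanced_def)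
  show "integrable (measure_pmf \<mu>) gap" "measure_pmf.expectation \<mu> gap = 0"
    using 1 2 by (auto simp: gap_def[abs_def])
  have le: "(\<integral>\<^sup>+x. ennreal ((gap x)\<^sup>2) \<partial>\<mu>) \<le> ennreal K"
    using assms by (simp add: balanced_def)
  then show int: "integrable (measure_pmf \<mu>) (\<lambda>x. (gap x)\<^sup>2)"
    by (intro integrableI_nonneg) (auto simp: le_less_trans)
  show eq: "(\<integral>\<^sup>+x. ennreal ((gap x)\<^sup>2) \<partial>\<mu>) =
      ennreal (measure_pmf.expectation \<mu> (\<lambda>x. (gap x)\<^sup>2))"
    using int by (intro nn_integral_eq_integral) auto
  show "measure_pmf.expectation \<mu> (\<lambda>x. (gap x)\<^sup>2) \<le> K"
    using le K unfolding eq by simp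
qed

text \<open>Gaps of the two independent pairs are centred, so the cross term vanishes.\<close>

lemma gap_sum_square:
  assumes \<mu>: "balanced l K \<mu>" and \<nu>: "balanced l K \<nu>" and l: "0 \<le> l" and K: "0 \<le> K"
  shows "integrable (measure_pmf (pair_pmf \<mu> \<nu>)) (\<lambda>x. (gap (fst x) + gap (snd x))\<^sup>2)"
    and "measure_pmf.expectation (pair_pmf \<mu> \<nu>) (\<lambda>x. (gap (fst x) + gap (snd x))\<^sup>2) =
      measure_pmf.expectation \<mu> (\<lambda>x. (gap x)\<^sup>2) + measure_pmf.expectation \<nu> (\<lambda>x. (gap x)\<^sup>2)"
proof -
  note m = balanced_gap[OF \<mu> l K] and n = balanced_gap[OF \<nu> l K]
  have sq: "(gap (fst x) + gap (snd x))\<^sup>2 =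
      (gap (fst x))\<^sup>2 + (gap (snd x))\<^sup>2 + 2 * (gap (fst x) * gap (snd x))"
    for x :: "(nat \<times> nat) \<times> (nat \<times> nat)"
    by (simp add: power2_eq_square algebra_simps)
  note ints = integrable_pair_pmf_fst[OF m(3), of \<nu>] integrable_pair_pmf_snd[OF n(3), of \<mu>]
    pair_pmf_product(1)[OF m(1) n(1)]
  show "integrable (measure_pmf (pair_pmf \<mu> \<nu>)) (\<lambda>x. (gap (fst x) + gap (snd x))\<^sup>2)"
    unfolding sq using ints by auto
  show "measure_pmf.expectation (pair_pmf \<mu> \<nu>) (\<lambda>x. (gap (fst x) + gap (snd x))\<^sup>2) =
      measure_pmf.expectation \<mu> (\<lambda>x. (gap x)\<^sup>2) + measure_pmf.expectation \<nu> (\<lambda>x. (gap x)\<^sup>2)"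
    unfolding sq using ints pair_pmf_product(2)[OF m(1) n(1)] m(2)
    by (simp add: expectation_pair_pmf_fst[where f = "\<lambda>x. (gap x)\<^sup>2"]
        expectation_pair_pmf_snd[where f = "\<lambda>x. (gap x)\<^sup>2"])
qed

lemma abs_le_square_int: "\<bar>j\<bar> \<le> j\<^sup>2" for j :: int
proof (cases "j = 0")
  case False
  then have "\<bar>j\<bar> * 1 \<le> \<bar>j\<bar> * \<bar>j\<bar>"
    by (intro mult_left_mono) auto
  then show ?thesis by (simp add: power2_eq_square)
qed simp

text \<open>Integrality of the gap enters here: without it the linear term in the cost after a collision
  could outweigh the gain in the quadratic one.\<close>

lemma abs_le_square_gap: "\<bar>gap a + gap b\<bar> \<le> (gap a + gap b)\<^sup>2"
proof -
  define z :: int where "z = int (fst a + fst b) - int (snd a + snd b)"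
  have z: "gap a + gap b = of_int z"
    by (simp add: gap_def z_def)
  note abs_le_square_int[of z]
  then show ?thesis
    unfolding z by (metis of_int_abs of_int_le_iff of_int_power)
qed

lemma nn_integral_gap_collide:
  "(\<integral>\<^sup>+x. ennreal ((gap x)\<^sup>2) \<partial>collide coupled_reshuffle \<mu> \<nu>) =
    (\<integral>\<^sup>+x. ennreal (((gap (fst x) + gap (snd x))\<^sup>2 + \<bar>gap (fst x) + gap (snd x)\<bar>) / 4)
      \<partial>pair_pmf \<mu> \<nu>)"
  by (simp add: collide_def case_prod_unfold nn_integral_gap_coupled_reshuffle)

text \<open>A collision does not increase the cost beyond the average of the two costs: the sum of
  the gaps has twice the average second moment, and by \<open>abs_le_square_gap\<close> half of that survives
  at most.\<close>

lemma balanced_collide: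
  assumes \<mu>: "balanced l K \<mu>" and \<nu>: "balanced l K \<nu>" and l: "0 \<le> l" and K: "0 \<le> K"
  shows "balanced l K (collide coupled_reshuffle \<mu> \<nu>)"
proof -
  have thin_mean: "(\<integral>\<^sup>+k. ennreal (real k) \<partial>thin j) = ennreal (real j / 2)" for j
    by (subst nn_integral_eq_integral) (simp_all add: expectation_thin)
  have average: "(\<integral>\<^sup>+a. \<integral>\<^sup>+b. ennreal (real (f a + f b) / 2) \<partial>\<nu> \<partial>\<mu>) = ennreal l"
    if "(\<integral>\<^sup>+x. ennreal (real (f x)) \<partial>\<mu>) = ennreal l" "(\<integral>\<^sup>+x. ennreal (real (f x)) \<partial>\<nu>) = ennreal l"
    for f :: "nat \<times> nat \<Rightarrow> nat"
  proof -
    have half: "ennreal (real (f a + f b) / 2) =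
        (ennreal (real (f a)) + ennreal (real (f b))) / 2" for a b
      by (simp add: ennreal_divide_numeral flip: ennreal_plus)
    have "(\<integral>\<^sup>+a. \<integral>\<^sup>+b. ennreal (real (f a + f b) / 2) \<partial>\<nu> \<partial>\<mu>) = (ennreal l + ennreal l) / 2"
      unfolding half using that
      by (simp add: nn_integral_divide nn_integral_add measure_pmf.emeasure_space_1)
    also have "\<dots> = ennreal l"
      using l by (simp add: ennreal_divide_numeral flip: ennreal_plus)
    finally show ?thesis .
  qed
  have fst: "(\<integral>\<^sup>+x. ennreal (real (fst x)) \<partial>coupled_reshuffle a b) = ennreal (real (fst a + fst b) / 2)"
    for a b
    using thin_mean[of "fst a + fst b"] unfolding map_fst_coupled_reshuffle[of a b, symmetric] by simp
  have snd: "(\<integral>\<^sup>+x. ennreal (real (snd x)) \<partial>coupled_reshuffle a b) = ennreal (real (snd a + snd b) / 2)"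
    for a b
    using thin_mean[of "snd a + snd b"] unfolding map_snd_coupled_reshuffle[of a b, symmetric] by simp
  have "(\<integral>\<^sup>+x. ennreal ((gap x)\<^sup>2) \<partial>collide coupled_reshuffle \<mu> \<nu>) \<le>
      (\<integral>\<^sup>+x. ennreal ((gap (fst x) + gap (snd x))\<^sup>2 / 2) \<partial>pair_pmf \<mu> \<nu>)"
    unfolding nn_integral_gap_collide
  proof (intro nn_integral_mono ennreal_leI)
    fix x :: "(nat \<times> nat) \<times> (nat \<times> nat)"
    show "((gap (fst x) + gap (snd x))\<^sup>2 + \<bar>gap (fst x) + gap (snd x)\<bar>) / 4 \<le>
        (gap (fst x) + gap (snd x))\<^sup>2 / 2"
      using abs_le_square_gap[of "fst x" "snd x"] by simp
  qed
  also have "\<dots> = ennreal ((measure_pmf.expectation \<mu> (\<lambda>x. (gap x)\<^sup>2)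
      + measure_pmf.expectation \<nu> (\<lambda>x. (gap x)\<^sup>2)) / 2)"
    using gap_sum_square[OF \<mu> \<nu> l K] by (subst nn_integral_eq_integral) auto
  also have "\<dots> \<le> ennreal K"
    using balanced_gap(5)[OF \<mu> l K] balanced_gap(5)[OF \<nu> l K] by (intro ennreal_leI) simp
  finally show ?thesis
    using \<mu> \<nu> average[of fst] average[of snd]
    by (simp add: balanced_def collide_def case_prod_unfold nn_integral_pair_pmf' fst snd)
qed

lemma balanced_wild:
  assumes \<mu>: "balanced l K \<mu>" and l: "0 \<le> l" and K: "0 \<le> K"
  shows "balanced l K (wild coupled_reshuffle \<mu> n)"
proof (induction n rule: less_induct)
  case (less n)
  show ?case
  proof (cases n)
    case 0
    then show ?thesis using \<mu> by simp
  next
    case (Suc m)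
    then show ?thesis
      using less by (auto intro!: balanced_bind_pmf balanced_collide l K)
  qed
qed

lemma balanced_evolve:
  assumes "balanced l K \<mu>" "0 \<le> l" "0 \<le> K"
  shows "balanced l K (evolve coupled_reshuffle \<mu> t)"
  unfolding evolve_def using assms by (intro balanced_bind_pmf balanced_wild)

section \<open>Dissipation of the coupling cost\<close>

text \<open>The function \<open>d\<^sup>2 - \<bar>d\<bar>\<close> is convex on the integers: it vanishes at \<open>-1\<close>, \<open>0\<close> and \<open>1\<close>,
  so the integers do not see its concave kink at \<open>0\<close>. This is its supporting line at
  \<open>i\<close>. Below, \<open>j\<close> is a centred variable independent of \<open>i\<close>, and the linear term averages out.\<close>

lemma excess_tangent:
  fixes i j :: int
  shows "i\<^sup>2 - \<bar>i\<bar> + (2 * i - sgn i) * j \<le> (i + j)\<^sup>2 - \<bar>i + j\<bar>"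
proof -
  consider "i = 0" | "i > 0" "i + j \<ge> 0" | "i > 0" "i + j < 0" | "i < 0" "i + j \<le> 0" | "i < 0" "i + j > 0"
    by linarith
  then show ?thesis
  proof cases
    case 1
    with abs_le_square_int[of j] show ?thesis by simp
  next
    case 2
    then have "(i + j)\<^sup>2 - \<bar>i + j\<bar> - (i\<^sup>2 - \<bar>i\<bar> + (2 * i - sgn i) * j) = j\<^sup>2"
      by (simp add: power2_eq_square algebra_simps)
    then show ?thesis by (smt (verit) zero_le_power2)
  next
    case 3
    then have "(i + j)\<^sup>2 - \<bar>i + j\<bar> - (i\<^sup>2 - \<bar>i\<bar> + (2 * i - sgn i) * j) = (j + 1)\<^sup>2 + 2 * i - 1"
      by (simp add: power2_eq_square algebra_simps)
    then show ?thesis using 3 by (smt (verit) zero_le_power2)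
  next
    case 4
    then have "(i + j)\<^sup>2 - \<bar>i + j\<bar> - (i\<^sup>2 - \<bar>i\<bar> + (2 * i - sgn i) * j) = j\<^sup>2"
      by (simp add: power2_eq_square algebra_simps)
    then show ?thesis by (smt (verit) zero_le_power2)
  next
    case 5
    then have "(i + j)\<^sup>2 - \<bar>i + j\<bar> - (i\<^sup>2 - \<bar>i\<bar> + (2 * i - sgn i) * j) = (j - 1)\<^sup>2 - 2 * i - 1"
      by (simp add: power2_eq_square algebra_simps)
    then show ?thesis using 5 by (smt (verit) zero_le_power2)
  qed
qed

text \<open>The left side is at most \<open>\<bar>i\<bar> + 1\<close> when \<open>i\<close> and \<open>j\<close> have the same sign, and at most
  \<open>0\<close> otherwise. For independent centred \<open>i\<close> and \<open>j\<close> of the same law the first term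
  averages out, and the second one to the square of the probability of a nonzero value.\<close>

lemma excess_sign:
  fixes i j :: int
  shows "i * sgn j + of_bool (i \<noteq> 0) * of_bool (j \<noteq> 0) \<le> (i + j)\<^sup>2 - \<bar>i + j\<bar>"
proof -
  have nonneg: "0 \<le> (i + j)\<^sup>2 - \<bar>i + j\<bar>"
    using excess_tangent[of 0 "i + j"] by simp
  consider "i = 0 \<or> j = 0" | "i > 0" "j > 0" | "i < 0" "j < 0" | "i > 0" "j < 0" | "i < 0" "j > 0"
    by linarith
  then show ?thesis
  proof cases
    case 1
    then show ?thesis using nonneg by auto
  next
    case 2
    then have "(i + 1) * 1 \<le> (i + j) * (i + j - 1)"
      by (intro mult_mono) auto
    with 2 show ?thesis by (simp add: power2_eq_square algebra_simps)
  next
    case 3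
    then have "(1 - i) * 1 \<le> (- i - j) * (- i - j - 1)"
      by (intro mult_mono) auto
    with 3 show ?thesis by (simp add: power2_eq_square algebra_simps)
  next
    case 4
    then show ?thesis using nonneg by simp
  next
    case 5
    then show ?thesis using nonneg by simp
  qed
qed

lemma square_le_excess:
  fixes i :: int
  shows "i\<^sup>2 \<le> of_bool (i \<noteq> 0) + 2 * (i\<^sup>2 - \<bar>i\<bar>)"
proof (cases "i = 0")
  case False
  have "0 \<le> (\<bar>i\<bar> - 1)\<^sup>2" by simp
  also have "(\<bar>i\<bar> - 1)\<^sup>2 = i\<^sup>2 - 2 * \<bar>i\<bar> + 1"
    by (simp add: power2_eq_square algebra_simps)
  finally show ?thesis using False by simp
qed simp

text \<open>Let \<open>A\<close> be the mean of \<open>D\<^sup>2 - \<bar>D\<bar>\<close> for the sum \<open>D\<close> of two independent gaps. A collision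
  lowers the cost \<open>w\<close> by exactly \<open>A / 4\<close>. Writing \<open>R\<close> for the mean of
  \<open>d\<^sup>2 - \<bar>d\<bar>\<close> for one gap \<open>d\<close> and \<open>q\<close> for the probability that it is nonzero, the three
  integer inequalities give \<open>R \<le> A\<close>, \<open>q\<^sup>2 \<le> A\<close> and \<open>w \<le> q + 2 * R\<close>. Gaps of size one are
  invisible to \<open>R\<close> and enter through \<open>q\<close>, which makes the bound on \<open>A\<close> quadratic in
  \<open>w\<close>: \<open>w\<^sup>2\<close> is at most \<open>2 * q\<^sup>2 + 8 * R\<^sup>2 \<le> 2 * A + 8 * A\<^sup>2\<close>, and one factor of the last term is
  absorbed by \<open>A \<le> 2 * w \<le> 2 * K\<close>.\<close>

lemma gap_dissipation:
  fixes \<mu> :: "(nat \<times> nat) pmf"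
  assumes \<mu>: "balanced l K \<mu>" and l: "0 \<le> l" and K: "0 \<le> K"
  defines "w \<equiv> measure_pmf.expectation \<mu> (\<lambda>x. (gap x)\<^sup>2)"
  shows "measure_pmf.expectation (collide coupled_reshuffle \<mu> \<mu>) (\<lambda>x. (gap x)\<^sup>2) - w
    \<le> - (w\<^sup>2 / (8 + 64 * K))"
proof -
  let ?E = "measure_pmf.expectation \<mu>" and ?P = "pair_pmf \<mu> \<mu>"
  let ?EP = "measure_pmf.expectation ?P"
  note m = balanced_gap[OF \<mu> l K]
  note sq = gap_sum_square[OF \<mu> \<mu> l K]
  define excess :: "real \<Rightarrow> real" where "excess d = d\<^sup>2 - \<bar>d\<bar>" for d
  define A where "A = ?EP (\<lambda>x. excess (gap (fst x) + gap (snd x)))"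
  define R where "R = ?E (\<lambda>x. excess (gap x))"
  define q :: real where "q = ?E (\<lambda>x. of_bool (gap x \<noteq> 0))"
  have w_nonneg: "0 \<le> w" and w_le: "w \<le> K"
    unfolding w_def using m(5) by simp_all
  have int_abs: "integrable ?P (\<lambda>x. \<bar>gap (fst x) + gap (snd x)\<bar>)"
    using integrable_pair_pmf_fst[OF m(1)] integrable_pair_pmf_snd[OF m(1)]
    by (intro integrable_abs Bochner_Integration.integrable_add)
  have int_excess: "integrable ?P (\<lambda>x. excess (gap (fst x) + gap (snd x)))"
    unfolding excess_def using sq(1) int_abs by (rule Bochner_Integration.integrable_diff)
  have int_R: "integrable \<mu> (\<lambda>x. excess (gap x))"
    unfolding excess_def using m(1,3) by auto
  have int_q: "integrable \<mu> (\<lambda>x. of_bool (gap x \<noteq> 0) :: real)"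
    by (rule integrable_pmf_bounded[of _ 1]) auto
  have int_sgn: "integrable \<mu> (\<lambda>x. sgn (gap x))"
    by (rule integrable_pmf_bounded[of _ 1]) (auto simp: sgn_if)

  have gap_int: "\<exists>z :: int. gap x = of_int z" for x
    by (rule exI[of _ "int (fst x) - int (snd x)"]) (simp add: gap_def)
  have sgn_int: "sgn (real_of_int z) = real_of_int (sgn z)" for z :: int
    by (simp add: sgn_if)
  have tangent: "excess (gap a) + (2 * gap a - sgn (gap a)) * gap b \<le> excess (gap a + gap b)" for a b
  proof -
    from gap_int obtain i j :: int where "gap a = of_int i" "gap b = of_int j" by metis
    moreover have "real_of_int (i\<^sup>2 - \<bar>i\<bar> + (2 * i - sgn i) * j) \<le> real_of_int ((i + j)\<^sup>2 - \<bar>i + j\<bar>)"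
      by (simp only: of_int_le_iff excess_tangent)
    ultimately show ?thesis by (simp add: excess_def sgn_int)
  qed
  have sign: "gap a * sgn (gap b) + of_bool (gap a \<noteq> 0) * of_bool (gap b \<noteq> 0)
      \<le> excess (gap a + gap b)" for a b
  proof -
    from gap_int obtain i j :: int where "gap a = of_int i" "gap b = of_int j" by metis
    moreover have "real_of_int (i * sgn j + of_bool (i \<noteq> 0) * of_bool (j \<noteq> 0))
        \<le> real_of_int ((i + j)\<^sup>2 - \<bar>i + j\<bar>)"
      by (simp only: of_int_le_iff excess_sign)
    ultimately show ?thesis by (simp add: excess_def sgn_int)
  qed
  have square: "(gap a)\<^sup>2 \<le> of_bool (gap a \<noteq> 0) + 2 * excess (gap a)" for a
  proof -
    from gap_int obtain i :: int where "gap a = of_int i" by metis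
    moreover have "real_of_int (i\<^sup>2) \<le> real_of_int (of_bool (i \<noteq> 0) + 2 * (i\<^sup>2 - \<bar>i\<bar>))"
      by (simp only: of_int_le_iff square_le_excess)
    ultimately show ?thesis by (simp add: excess_def)
  qed

  have "R \<le> A"
  proof -
    have int: "integrable \<mu> (\<lambda>x. 2 * gap x - sgn (gap x))"
      using m(1) int_sgn by auto
    note prod = pair_pmf_product[OF int m(1)]
    have "?EP (\<lambda>x. excess (gap (fst x)) + (2 * gap (fst x) - sgn (gap (fst x))) * gap (snd x)) \<le> A"
      unfolding A_def
      by (intro integral_mono int_excess Bochner_Integration.integrable_add prod(1)
          integrable_pair_pmf_fst[OF int_R] tangent)
    also have "?EP (\<lambda>x. excess (gap (fst x)) + (2 * gap (fst x) - sgn (gap (fst x))) * gap (snd x))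
        = R"
      using integrable_pair_pmf_fst[OF int_R, of \<mu>] prod m(2)
        expectation_pair_pmf_fst[of \<mu> \<mu> "\<lambda>x. excess (gap x)"]
      by (simp add: R_def)
    finally show ?thesis .
  qed
  moreover have "q\<^sup>2 \<le> A"
  proof -
    note p1 = pair_pmf_product[OF m(1) int_sgn] and p2 = pair_pmf_product[OF int_q int_q]
    have "?EP (\<lambda>x. gap (fst x) * sgn (gap (snd x))
        + of_bool (gap (fst x) \<noteq> 0) * of_bool (gap (snd x) \<noteq> 0)) \<le> A"
      unfolding A_def
      by (intro integral_mono int_excess Bochner_Integration.integrable_add p1(1) p2(1) sign)
    also have "?EP (\<lambda>x. gap (fst x) * sgn (gap (snd x))
        + of_bool (gap (fst x) \<noteq> 0) * of_bool (gap (snd x) \<noteq> 0)) = q\<^sup>2"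
      using p1 p2 m(2) by (simp add: q_def power2_eq_square)
    finally show ?thesis .
  qed
  moreover have "w \<le> q + 2 * R"
  proof -
    have "w \<le> ?E (\<lambda>x. of_bool (gap x \<noteq> 0) + 2 * excess (gap x))"
      unfolding w_def using int_q int_R m(3) by (intro integral_mono square) auto
    also have "\<dots> = q + 2 * R"
      using int_q int_R by (simp add: q_def R_def)
    finally show ?thesis .
  qed
  moreover have "A \<le> 2 * w"
  proof -
    have "A \<le> ?EP (\<lambda>x. (gap (fst x) + gap (snd x))\<^sup>2)"
      unfolding A_def by (intro integral_mono int_excess sq(1)) (simp add: excess_def)
    then show ?thesis using sq(2) by (simp add: w_def)
  qed
  ultimately have w2: "w\<^sup>2 \<le> A * (2 + 16 * K)"
  proof -
    assume RA: "R \<le> A" and qA: "q\<^sup>2 \<le> A" and wq: "w \<le> q + 2 * R" and Aw: "A \<le> 2 * w"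
    have A0: "0 \<le> A" using qA by (smt (verit) zero_le_power2)
    have "w \<le> q + 2 * A" using wq RA by linarith
    then have "w\<^sup>2 \<le> (q + 2 * A)\<^sup>2"
      using w_nonneg by (intro power_mono)
    also have "\<dots> \<le> 2 * q\<^sup>2 + 2 * (2 * A)\<^sup>2"
      using zero_le_power2[of "q - 2 * A"] by (simp add: power2_eq_square algebra_simps)
    also have "\<dots> \<le> 2 * A + 8 * (A * (2 * K))"
    proof -
      have "A * A \<le> A * (2 * K)"
        using Aw w_le A0 by (intro mult_left_mono) auto
      then show ?thesis using qA by (simp add: power2_eq_square)
    qed
    finally show ?thesis by (simp add: algebra_simps)
  qed
  have "measure_pmf.expectation (collide coupled_reshuffle \<mu> \<mu>) (\<lambda>x. (gap x)\<^sup>2) = w - A / 4"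
  proof -
    note c = balanced_gap[OF balanced_collide[OF \<mu> \<mu> l K] l K]
    have int: "integrable ?P (\<lambda>x. ((gap (fst x) + gap (snd x))\<^sup>2
        + \<bar>gap (fst x) + gap (snd x)\<bar>) / 4)"
      using sq(1) int_abs by auto
    have "ennreal (measure_pmf.expectation (collide coupled_reshuffle \<mu> \<mu>) (\<lambda>x. (gap x)\<^sup>2)) =
        ennreal (?EP (\<lambda>x. ((gap (fst x) + gap (snd x))\<^sup>2 + \<bar>gap (fst x) + gap (snd x)\<bar>) / 4))"
      unfolding c(4)[symmetric] nn_integral_gap_collide
      using int by (intro nn_integral_eq_integral) auto
    then have "measure_pmf.expectation (collide coupled_reshuffle \<mu> \<mu>) (\<lambda>x. (gap x)\<^sup>2) =
        ?EP (\<lambda>x. ((gap (fst x) + gap (snd x))\<^sup>2 + \<bar>gap (fst x) + gap (snd x)\<bar>) / 4)"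
      by (subst (asm) ennreal_inj) auto
    also have "\<dots> = ?EP (\<lambda>x. (gap (fst x) + gap (snd x))\<^sup>2 / 2
        - excess (gap (fst x) + gap (snd x)) / 4)"
      by (intro Bochner_Integration.integral_cong) (auto simp: excess_def field_simps)
    also have "\<dots> = w - A / 4"
      using sq int_excess by (simp add: A_def w_def)
    finally show ?thesis .
  qed
  moreover have "w\<^sup>2 / (8 + 64 * K) \<le> A / 4"
    using w2 K by (simp add: divide_simps) (simp add: algebra_simps)
  ultimately show ?thesis by simp
qed

text \<open>The Riccati inequality \<open>w' \<le> - w\<^sup>2 / c\<close> says that \<open>1 / w\<close> grows at rate at least
  \<open>1 / c\<close>. If \<open>w\<close> is positive at time \<open>t\<close>, it is positive before, because it
  decreases.\<close>

lemma quadratic_decay: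
  fixes w w' :: "real \<Rightarrow> real"
  assumes deriv: "\<And>s. 0 \<le> s \<Longrightarrow> (w has_real_derivative w' s) (at s within {0..})"
    and decay: "\<And>s. 0 \<le> s \<Longrightarrow> w' s \<le> - ((w s)\<^sup>2 / c)"
    and nonneg: "\<And>s. 0 \<le> s \<Longrightarrow> 0 \<le> w s"
    and c: "0 < c" and t: "0 < t"
  shows "w t \<le> c / t"
proof (cases "w t = 0")
  case True
  then show ?thesis using c t by simp
next
  case False
  then have wt: "0 < w t" using nonneg[of t] t by simp
  have at: "at s within {0..} = at s" if "0 < s" for s :: real
    using that by (intro at_within_interior) (simp add: interior_real_atLeast)
  have cont: "continuous_on {0..} w"
    by (rule DERIV_continuous_on[of _ _ w']) (auto intro: deriv)
  have pos: "0 < w s" if s: "0 \<le> s" "s \<le> t" for s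
  proof -
    have "- w s \<le> - w t"
    proof (rule DERIV_nonneg_imp_increasing_open[where f = "\<lambda>s. - w s"])
      fix r assume "s < r" "r < t"
      then have r: "0 < r" using s by simp
      have "0 \<le> (w r)\<^sup>2 / c" using c by simp
      then have "0 \<le> - w' r" using decay[of r] r by simp
      moreover have "((\<lambda>s. - w s) has_real_derivative - w' r) (at r)"
        using deriv[of r] r by (intro DERIV_minus) (simp add: at)
      ultimately show "\<exists>y. ((\<lambda>s. - w s) has_real_derivative y) (at r) \<and> 0 \<le> y" by blast
    next
      show "continuous_on {s..t} (\<lambda>s. - w s)"
        by (intro continuous_on_minus continuous_on_subset[OF cont]) (use s in auto)
    qed (use s in auto)
    then show ?thesis using wt by simp
  qed
  have "1 / w 0 - 0 / c \<le> 1 / w t - t / c"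
  proof (rule DERIV_nonneg_imp_increasing_open[where f = "\<lambda>s. 1 / w s - s / c"])
    fix r assume r: "0 < r" "r < t"
    then have w: "0 < w r" using pos by simp
    have "(w has_real_derivative w' r) (at r)"
      using deriv[of r] r by (simp add: at)
    then have "((\<lambda>s. 1 / w s - s / c) has_real_derivative - (w' r / (w r)\<^sup>2) - 1 / c) (at r)"
      using w c by (auto intro!: derivative_eq_intros simp: power2_eq_square)
    moreover have "0 \<le> - (w' r / (w r)\<^sup>2) - 1 / c"
      using decay[of r] r w c by (simp add: field_simps)
    ultimately show "\<exists>y. ((\<lambda>s. 1 / w s - s / c) has_real_derivative y) (at r) \<and> 0 \<le> y" by blast
  next
    have "continuous_on {0..t} w"
      by (rule continuous_on_subset[OF cont]) auto
    moreover have "\<forall>s\<in>{0..t}. w s \<noteq> 0"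
      using pos by force
    ultimately show "continuous_on {0..t} (\<lambda>s. 1 / w s - s / c)"
      using c by (intro continuous_intros) auto
  qed (use t in auto)
  moreover have "0 \<le> 1 / w 0" using pos[of 0] t by simp
  ultimately have "t / c \<le> 1 / w t" by linarith
  then show ?thesis using wt c t by (simp add: field_simps)
qed

section \<open>Convergence in Wasserstein distance\<close>

text \<open>The independent coupling starts the evolution: its cost is the sum of the variances.\<close>

lemma balanced_pair_pmf:
  assumes l: "0 \<le> l"
    and p: "integrable (measure_pmf p) real" "measure_pmf.expectation p real = l"
      "integrable (measure_pmf p) (\<lambda>n. (real n - l)\<^sup>2)"
    and q: "integrable (measure_pmf q) real" "measure_pmf.expectation q real = l"
      "integrable (measure_pmf q) (\<lambda>n. (real n - l)\<^sup>2)"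
  shows "balanced l (measure_pmf.expectation p (\<lambda>n. (real n - l)\<^sup>2)
      + measure_pmf.expectation q (\<lambda>n. (real n - l)\<^sup>2)) (pair_pmf p q)"
proof -
  have cp: "integrable p (\<lambda>n. real n - l)" "measure_pmf.expectation p (\<lambda>n. real n - l) = 0"
    and cq: "integrable q (\<lambda>n. real n - l)" "measure_pmf.expectation q (\<lambda>n. real n - l) = 0"
    using p q by simp_all
  have sq: "(gap x)\<^sup>2 = (real (fst x) - l)\<^sup>2 + (real (snd x) - l)\<^sup>2
      - 2 * ((real (fst x) - l) * (real (snd x) - l))" for x
    by (simp add: gap_def power2_eq_square algebra_simps)
  note ints = integrable_pair_pmf_fst[OF p(3), of q] integrable_pair_pmf_snd[OF q(3), of p]
    pair_pmf_product[OF cp(1) cq(1)]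
  have int: "integrable (pair_pmf p q) (\<lambda>x. (gap x)\<^sup>2)"
    unfolding sq using ints by auto
  have E: "measure_pmf.expectation (pair_pmf p q) (\<lambda>x. (gap x)\<^sup>2) =
      measure_pmf.expectation p (\<lambda>n. (real n - l)\<^sup>2)
      + measure_pmf.expectation q (\<lambda>n. (real n - l)\<^sup>2)"
    unfolding sq using ints cp cq
    by (simp add: expectation_pair_pmf_fst[where f = "\<lambda>n. (real n - l)\<^sup>2"]
        expectation_pair_pmf_snd[where f = "\<lambda>n. (real n - l)\<^sup>2"])
  have "(\<integral>\<^sup>+x. ennreal ((gap x)\<^sup>2) \<partial>pair_pmf p q) =
      ennreal (measure_pmf.expectation p (\<lambda>n. (real n - l)\<^sup>2)
      + measure_pmf.expectation q (\<lambda>n. (real n - l)\<^sup>2))"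
    unfolding E[symmetric] using int by (intro nn_integral_eq_integral) auto
  moreover have "(\<integral>\<^sup>+n. ennreal (real n) \<partial>p) = ennreal l" "(\<integral>\<^sup>+n. ennreal (real n) \<partial>q) = ennreal l"
    using p(1,2) q(1,2) by (simp_all add: nn_integral_eq_integral)
  ultimately show ?thesis
    by (simp add: balanced_def nn_integral_pair_pmf' measure_pmf.emeasure_space_1)
qed

lemma W2_le_coupling:
  assumes "map_pmf fst \<pi> = p" "map_pmf snd \<pi> = q"
    and "(\<integral>\<^sup>+x. ennreal ((gap x)\<^sup>2) \<partial>\<pi>) = ennreal w" "0 \<le> w"
  shows "W2 p q \<le> ennreal (sqrt w)"
proof -
  have "W2 p q \<le> ennreal_sqrt (\<integral>\<^sup>+ (x, y). ennreal (\<bar>real x - real y\<bar>\<^sup>2) \<partial>measure_pmf \<pi>)"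
    unfolding W2_def using assms by (intro INF_lower) (simp add: couplings_def)
  also have "(\<integral>\<^sup>+ (x, y). ennreal (\<bar>real x - real y\<bar>\<^sup>2) \<partial>measure_pmf \<pi>) = ennreal w"
    using assms by (simp add: case_prod_unfold gap_def)
  also have "ennreal_sqrt (ennreal w) = ennreal (sqrt w)"
    using assms by (simp add: ennreal_sqrt_def)
  finally show ?thesis .
qed

text \<open>The evolved coupling has the given solution and the Poisson law as its marginals, the former by
  uniqueness, the latter by stationarity, so its cost bounds the squared distance.\<close>

lemma W2_poisson_decay:
  fixes p :: "real \<Rightarrow> nat pmf"
  assumes l: "0 < l"
    and p0: "integrable (measure_pmf (p 0)) real" "measure_pmf.expectation (p 0) real = l"
      "integrable (measure_pmf (p 0)) (\<lambda>n. (real n - l)\<^sup>2)"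
    and sol: "Q_solution p" and t: "0 < t"
  defines "v \<equiv> measure_pmf.expectation (p 0) (\<lambda>n. (real n - l)\<^sup>2)"
  shows "W2 (p t) (poisson_pmf l) \<le> ennreal (sqrt ((8 + 64 * (v + l)) / t))"
proof -
  define \<mu> where "\<mu> = evolve coupled_reshuffle (pair_pmf (p 0) (poisson_pmf l))"
  define w where "w s = measure_pmf.expectation (\<mu> s) (\<lambda>x. (gap x)\<^sup>2)" for s
  have v: "0 \<le> v" unfolding v_def by simp
  have K: "0 \<le> v + l" and l0: "0 \<le> l" using v l by simp_all
  have init: "balanced l (v + l) (pair_pmf (p 0) (poisson_pmf l))"
    using balanced_pair_pmf[OF l0 p0 poisson_moments(1,2,3)[OF l]] poisson_moments(4)[OF l]
    by (simp add: v_def)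
  have bal: "balanced l (v + l) (\<mu> s)" for s
    unfolding \<mu>_def by (rule balanced_evolve[OF init l0 K])
  have "map_pmf fst (\<mu> t) = evolve reshuffle (p 0) t"
    unfolding \<mu>_def by (simp add: map_pmf_evolve[where S' = reshuffle] map_fst_coupled_reshuffle map_fst_pair_pmf)
  also have "\<dots> = p t"
    by (rule Q_solution_unique[OF Q_solution_evolve sol]) (use t in \<open>simp_all add: evolve_0\<close>)
  finally have fst: "map_pmf fst (\<mu> t) = p t" .
  have "map_pmf snd (\<mu> t) = evolve reshuffle (poisson_pmf l) t"
    unfolding \<mu>_def by (simp add: map_pmf_evolve[where S' = reshuffle] map_snd_coupled_reshuffle map_snd_pair_pmf)
  also have "\<dots> = poisson_pmf l"
    by (rule evolve_fixed_point[OF collide_poisson[OF l]])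
  finally have snd: "map_pmf snd (\<mu> t) = poisson_pmf l" .
  have "w t \<le> (8 + 64 * (v + l)) / t"
  proof (rule quadratic_decay)
    show "(w has_real_derivative
        measure_pmf.expectation (collide coupled_reshuffle (\<mu> s) (\<mu> s)) (\<lambda>x. (gap x)\<^sup>2) - w s)
        (at s within {0..})" if "0 \<le> s" for s
      unfolding w_def[abs_def] \<mu>_def using balanced_wild[OF init l0 K] that
      by (intro evolve_has_derivative[where K = "v + l"]) (auto simp: balanced_def)
    show "measure_pmf.expectation (collide coupled_reshuffle (\<mu> s) (\<mu> s)) (\<lambda>x. (gap x)\<^sup>2) - w s
        \<le> - ((w s)\<^sup>2 / (8 + 64 * (v + l)))" for s
      unfolding w_def by (rule gap_dissipation[OF bal l0 K])
  qed (use K t in \<open>auto simp: w_def\<close>)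
  then have "sqrt (w t) \<le> sqrt ((8 + 64 * (v + l)) / t)"
    by simp
  moreover have "W2 (p t) (poisson_pmf l) \<le> ennreal (sqrt (w t))"
    by (rule W2_le_coupling[OF fst snd]) (simp_all add: w_def balanced_gap(4)[OF bal l0 K])
  ultimately show ?thesis
    by (meson ennreal_leI order_trans)
qed

theorem theorem1:
  fixes l :: real
  assumes "l > 0"
  shows "\<exists>C :: real \<Rightarrow> real. (\<forall>v. C v > 0) \<and>
    (\<forall>(p :: real \<Rightarrow> nat pmf) (\<sigma> :: real).
       integrable (measure_pmf (p 0)) real \<longrightarrow>
       measure_pmf.expectation (p 0) real = l \<longrightarrow>
       integrable (measure_pmf (p 0)) (\<lambda>n. (real n - l)\<^sup>2) \<longrightarrow>
       measure_pmf.variance (p 0) real = \<sigma>\<^sup>2 \<longrightarrow>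
       Q_solution p \<longrightarrow>
       (\<forall>t>0. W2 (p t) (poisson_pmf l) \<le> ennreal (C (\<sigma>\<^sup>2) * t powr (- 1 / 2))))"
proof (intro exI[of _ "\<lambda>v. sqrt (8 + 64 * (\<bar>v\<bar> + l))"] conjI allI impI)
  \<comment> \<open>The absolute value only makes the constant positive at negative arguments.\<close>
  fix v
  show "0 < sqrt (8 + 64 * (\<bar>v\<bar> + l))"
    using assms by (simp add: add_pos_nonneg)
next
  fix p :: "real \<Rightarrow> nat pmf" and \<sigma> t :: real
  assume p: "integrable (measure_pmf (p 0)) real" "measure_pmf.expectation (p 0) real = l"
    "integrable (measure_pmf (p 0)) (\<lambda>n. (real n - l)\<^sup>2)"
    and var: "measure_pmf.variance (p 0) real = \<sigma>\<^sup>2" and sol: "Q_solution p" and t: "0 < t"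
  have v: "measure_pmf.expectation (p 0) (\<lambda>n. (real n - l)\<^sup>2) = \<sigma>\<^sup>2"
    using var p(2) by simp
  have "sqrt ((8 + 64 * (\<sigma>\<^sup>2 + l)) / t) = sqrt (8 + 64 * (\<bar>\<sigma>\<^sup>2\<bar> + l)) * t powr (- 1 / 2)"
    using t powr_minus_divide[of t "1 / 2"] by (simp add: real_sqrt_divide powr_half_sqrt)
  then show "W2 (p t) (poisson_pmf l) \<le> ennreal (sqrt (8 + 64 * (\<bar>\<sigma>\<^sup>2\<bar> + l)) * t powr (- 1 / 2))"
    using W2_poisson_decay[OF assms p sol t] by (simp add: v)
qed

end
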